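(* Let $\mathcal X$ and $\mathcal Y$ be infinite dimensional complex Banach spaces and let $A\in L(\mathcal X)$ and $B\in L(\mathcal Y)$ be polaroid operators. Then the generalized derivation $\rho\in L(L(\mathcal Y,\mathcal X))$ defined by $A$ and $B$, i.e. $\rho(U)=AU-UB$ for $U\in L(\mathcal Y,\mathcal X)$, is polaroid.
   Context: $L(\mathcal Y,\mathcal X)$ is the Banach space of bounded linear maps from $\mathcal Y$ to $\mathcal X$ and $L(\mathcal X)=L(\mathcal X,\mathcal X)$. For a bounded operator $T$ on a Banach space, $N(T)$ and $R(T)$ are its null space and range; $\mathrm{asc}(T)$ is the smallest integer $a\ge0$ with $N(T^a)=N(T^{a+1})$, and $\mathrm{dsc}(T)$ the smallest integer $d\ge 0$ with $R(T^d)=R(T^{d+1})$ (each $\infty$ if no such integer exists). $\sigma(T)$ is the spectrum, $\mathrm{iso}\,\sigma(T)$ the set of its isolated points, and $\Pi(T)=\{\lambda\in\sigma(T): \mathrm{asc}(T-\lambda)=\mathrm{dsc}(T-\lambda)<\infty\}$ is the set of poles of $T$. $T$ is polaroid if $\mathrm{iso}\,\sigma(T)=\Pi(T)$. *)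

theory Defs
  imports "HOL-Analysis.Analysis"
begin

section \<open>Complex normed and Banach spaces\<close>

class complex_vector = real_vector +
  fixes scaleC :: "complex \<Rightarrow> 'a \<Rightarrow> 'a"  (infixr \<open>*\<^sub>C\<close> 75)
  assumes scaleC_add_right: "a *\<^sub>C (x + y) = a *\<^sub>C x + a *\<^sub>C y"
    and scaleC_add_left: "(a + b) *\<^sub>C x = a *\<^sub>C x + b *\<^sub>C x"
    and scaleC_scaleC: "a *\<^sub>C (b *\<^sub>C x) = (a * b) *\<^sub>C x"
    and scaleC_of_real: "complex_of_real r *\<^sub>C x = r *\<^sub>R x"

lemma scaleC_one: "1 *\<^sub>C x = (x :: 'a::complex_vector)"
  using scaleC_of_real[of 1 x] by simp

global_interpretation complex_vector:
  vector_space "scaleC :: complex \<Rightarrow> 'a \<Rightarrow> 'a::complex_vector"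
  defines cspan = complex_vector.span
  by unfold_locales (simp_all add: scaleC_add_right scaleC_add_left scaleC_scaleC scaleC_one)

class complex_normed_vector = complex_vector + real_normed_vector +
  assumes norm_scaleC: "norm (a *\<^sub>C x) = cmod a * norm x"

class cbanach = complex_normed_vector + complete_space

subclass (in cbanach) banach ..


section \<open>The Banach space of bounded complex linear maps\<close>

definition bounded_clinear :: "('a::complex_normed_vector \<Rightarrow> 'b::complex_normed_vector) \<Rightarrow> bool"
  where "bounded_clinear f \<longleftrightarrow> bounded_linear f \<and> (\<forall>c x. f (c *\<^sub>C x) = c *\<^sub>C f x)"

lemma bounded_linear_scaleC:
  "bounded_linear (\<lambda>x. c *\<^sub>C x :: 'a::complex_normed_vector)"
proof (rule bounded_linear_intro)
  show "c *\<^sub>C (x + y) = c *\<^sub>C x + c *\<^sub>C y" for x y :: 'a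
    by (rule scaleC_add_right)
  show "c *\<^sub>C (r *\<^sub>R x) = r *\<^sub>R (c *\<^sub>C x)" for r and x :: 'a
    by (simp flip: scaleC_of_real add: scaleC_scaleC mult.commute)
  show "norm (c *\<^sub>C x) \<le> norm x * cmod c" for x :: 'a
    by (simp add: norm_scaleC)
qed

lemma onorm_scaleC:
  fixes f :: "'a::real_normed_vector \<Rightarrow> 'b::complex_normed_vector"
  assumes "bounded_linear f"
  shows "onorm (\<lambda>x. c *\<^sub>C f x) = cmod c * onorm f"
proof -
  have le: "onorm (\<lambda>x. c *\<^sub>C f x) \<le> cmod c * onorm f"
    if "bounded_linear f" for c and f :: "'a \<Rightarrow> 'b"
  proof (rule onorm_bound)
    show "norm (c *\<^sub>C f x) \<le> cmod c * onorm f * norm x" for x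
      using onorm[OF that, of x] by (simp add: norm_scaleC mult_left_mono mult.assoc)
  qed (simp add: onorm_pos_le[OF that])
  have "cmod c * onorm f \<le> onorm (\<lambda>x. c *\<^sub>C f x)"
  proof (cases "c = 0")
    case True
    have "bounded_linear (\<lambda>x. c *\<^sub>C f x)"
      using bounded_linear_compose[OF bounded_linear_scaleC assms] .
    then show ?thesis using True by (simp add: onorm_pos_le)
  next
    case False
    have bl: "bounded_linear (\<lambda>x. c *\<^sub>C f x)"
      using bounded_linear_compose[OF bounded_linear_scaleC assms] .
    have "onorm f = onorm (\<lambda>x. inverse c *\<^sub>C (c *\<^sub>C f x))"
      using False by (simp add: scaleC_scaleC scaleC_one)
    also have "\<dots> \<le> cmod (inverse c) * onorm (\<lambda>x. c *\<^sub>C f x)"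
      by (rule le[OF bl])
    finally show ?thesis
      using False by (simp add: norm_inverse norm_divide field_simps)
  qed
  with le[OF assms] show ?thesis
    by (rule antisym)
qed

typedef (overloaded) ('a, 'b) cblinfun  (\<open>(_ \<Rightarrow>\<^sub>C\<^sub>L /_)\<close> [22, 21] 21) =
  "{f :: 'a::complex_normed_vector \<Rightarrow> 'b::complex_normed_vector. bounded_clinear f}"
  morphisms cblinfun_apply CBlinfun
  by (rule exI[of _ "\<lambda>_. 0"]) (simp add: bounded_clinear_def complex_vector.scale_zero_right)

setup_lifting type_definition_cblinfun

lemma cblinfun_eqI: "(\<And>x. cblinfun_apply f x = cblinfun_apply g x) \<Longrightarrow> f = g"
  by transfer auto

instantiation cblinfun :: (complex_normed_vector, complex_normed_vector) complex_normed_vector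
begin

lift_definition norm_cblinfun :: "('a \<Rightarrow>\<^sub>C\<^sub>L 'b) \<Rightarrow> real" is onorm .

lift_definition zero_cblinfun :: "'a \<Rightarrow>\<^sub>C\<^sub>L 'b" is "\<lambda>x. 0"
  by (simp add: bounded_clinear_def complex_vector.scale_zero_right)

lift_definition plus_cblinfun :: "('a \<Rightarrow>\<^sub>C\<^sub>L 'b) \<Rightarrow> ('a \<Rightarrow>\<^sub>C\<^sub>L 'b) \<Rightarrow> 'a \<Rightarrow>\<^sub>C\<^sub>L 'b"
  is "\<lambda>f g x. f x + g x"
  by (simp add: bounded_clinear_def bounded_linear_add scaleC_add_right)

lift_definition minus_cblinfun :: "('a \<Rightarrow>\<^sub>C\<^sub>L 'b) \<Rightarrow> ('a \<Rightarrow>\<^sub>C\<^sub>L 'b) \<Rightarrow> 'a \<Rightarrow>\<^sub>C\<^sub>L 'b"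
  is "\<lambda>f g x. f x - g x"
  by (simp add: bounded_clinear_def bounded_linear_sub complex_vector.scale_right_diff_distrib)

lift_definition uminus_cblinfun :: "('a \<Rightarrow>\<^sub>C\<^sub>L 'b) \<Rightarrow> 'a \<Rightarrow>\<^sub>C\<^sub>L 'b" is "\<lambda>f x. - f x"
  by (simp add: bounded_clinear_def bounded_linear_minus complex_vector.scale_minus_right)

lift_definition scaleR_cblinfun :: "real \<Rightarrow> ('a \<Rightarrow>\<^sub>C\<^sub>L 'b) \<Rightarrow> 'a \<Rightarrow>\<^sub>C\<^sub>L 'b"
  is "\<lambda>r f x. r *\<^sub>R f x"
  by (auto simp: bounded_clinear_def bounded_linear_const_scaleR)
    (simp add: scaleC_scaleC mult.commute flip: scaleC_of_real)

lift_definition scaleC_cblinfun :: "complex \<Rightarrow> ('a \<Rightarrow>\<^sub>C\<^sub>L 'b) \<Rightarrow> 'a \<Rightarrow>\<^sub>C\<^sub>L 'b"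
  is "\<lambda>c f x. c *\<^sub>C f x"
  by (simp add: bounded_clinear_def scaleC_scaleC mult.commute
        bounded_linear_compose[OF bounded_linear_scaleC])

definition dist_cblinfun :: "('a \<Rightarrow>\<^sub>C\<^sub>L 'b) \<Rightarrow> ('a \<Rightarrow>\<^sub>C\<^sub>L 'b) \<Rightarrow> real"
  where "dist_cblinfun f g = norm (f - g)"

definition uniformity_cblinfun :: "(('a \<Rightarrow>\<^sub>C\<^sub>L 'b) \<times> ('a \<Rightarrow>\<^sub>C\<^sub>L 'b)) filter"
  where "uniformity_cblinfun = (INF e\<in>{0 <..}. principal {(x, y). dist x y < e})"

definition open_cblinfun :: "('a \<Rightarrow>\<^sub>C\<^sub>L 'b) set \<Rightarrow> bool"
  where "open_cblinfun S = (\<forall>x\<in>S. \<forall>\<^sub>F (x', y) in uniformity. x' = x \<longrightarrow> y \<in> S)"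

definition sgn_cblinfun :: "('a \<Rightarrow>\<^sub>C\<^sub>L 'b) \<Rightarrow> 'a \<Rightarrow>\<^sub>C\<^sub>L 'b"
  where "sgn_cblinfun f = inverse (norm f) *\<^sub>R f"

instance
proof
  fix f g h :: "'a \<Rightarrow>\<^sub>C\<^sub>L 'b" and a b :: complex and r s :: real
  show "f + g + h = f + (g + h)" by transfer (simp add: add.assoc)
  show "f + g = g + f" by transfer (simp add: add.commute)
  show "0 + f = f" by transfer simp
  show "- f + f = 0" by transfer simp
  show "f - g = f + - g" by transfer simp
  show "r *\<^sub>R (f + g) = r *\<^sub>R f + r *\<^sub>R g" by transfer (simp add: scaleR_add_right)
  show "(r + s) *\<^sub>R f = r *\<^sub>R f + s *\<^sub>R f" by transfer (simp add: scaleR_add_left)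
  show "r *\<^sub>R s *\<^sub>R f = (r * s) *\<^sub>R f" by transfer simp
  show "1 *\<^sub>R f = f" by transfer simp
  show "a *\<^sub>C (f + g) = a *\<^sub>C f + a *\<^sub>C g" by transfer (simp add: scaleC_add_right)
  show "(a + b) *\<^sub>C f = a *\<^sub>C f + b *\<^sub>C f" by transfer (simp add: scaleC_add_left)
  show "a *\<^sub>C b *\<^sub>C f = (a * b) *\<^sub>C f" by transfer (simp add: scaleC_scaleC)
  show "complex_of_real r *\<^sub>C f = r *\<^sub>R f" by transfer (simp add: scaleC_of_real)
  show "dist f g = norm (f - g)" by (fact dist_cblinfun_def)
  show "sgn f = inverse (norm f) *\<^sub>R f" by (fact sgn_cblinfun_def)
  show "uniformity = (INF e\<in>{0 <..}. principal {(x :: 'a \<Rightarrow>\<^sub>C\<^sub>L 'b, y). dist x y < e})"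
    by (fact uniformity_cblinfun_def)
  show "open S \<longleftrightarrow> (\<forall>x\<in>S. \<forall>\<^sub>F (x', y) in uniformity. x' = x \<longrightarrow> y \<in> S)"
    for S :: "('a \<Rightarrow>\<^sub>C\<^sub>L 'b) set"
    by (fact open_cblinfun_def)
  show "norm f = 0 \<longleftrightarrow> f = 0" by transfer (auto simp: bounded_clinear_def onorm_eq_0)
  show "norm (f + g) \<le> norm f + norm g"
    by transfer (simp add: bounded_clinear_def onorm_triangle)
  show "norm (r *\<^sub>R f) = \<bar>r\<bar> * norm f" by transfer (simp add: bounded_clinear_def onorm_scaleR)
  show "norm (a *\<^sub>C f) = cmod a * norm f" by transfer (simp add: bounded_clinear_def onorm_scaleC)
qed

end

lift_definition blinfun_of_cblinfun ::
  "('a::complex_normed_vector \<Rightarrow>\<^sub>C\<^sub>L 'b::complex_normed_vector) \<Rightarrow> 'a \<Rightarrow>\<^sub>L 'b" is "\<lambda>f. f"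
  by (simp add: bounded_clinear_def)

lemma dist_blinfun_of_cblinfun: "dist (blinfun_of_cblinfun f) (blinfun_of_cblinfun g) = dist f g"
  unfolding dist_norm by transfer simp

instance cblinfun :: (complex_normed_vector, cbanach) cbanach
proof
  fix X :: "nat \<Rightarrow> 'a \<Rightarrow>\<^sub>C\<^sub>L 'b"
  assume "Cauchy X"
  then have "Cauchy (\<lambda>n. blinfun_of_cblinfun (X n))"
    by (simp add: Cauchy_def dist_blinfun_of_cblinfun)
  then obtain L where L: "(\<lambda>n. blinfun_of_cblinfun (X n)) \<longlonglongrightarrow> L"
    using Cauchy_convergent_iff convergent_def by blast
  have lim: "(\<lambda>n. blinfun_apply (blinfun_of_cblinfun (X n)) x) \<longlonglongrightarrow> blinfun_apply L x" for x
    by (intro blinfun.tendsto L tendsto_const)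
  have "blinfun_apply L (c *\<^sub>C x) = c *\<^sub>C blinfun_apply L x" for c x
  proof (rule LIMSEQ_unique[OF lim])
    have "blinfun_apply (blinfun_of_cblinfun (X n)) (c *\<^sub>C x)
        = c *\<^sub>C blinfun_apply (blinfun_of_cblinfun (X n)) x" for n
      by transfer (simp add: bounded_clinear_def)
    then show "(\<lambda>n. blinfun_apply (blinfun_of_cblinfun (X n)) (c *\<^sub>C x))
        \<longlonglongrightarrow> c *\<^sub>C blinfun_apply L x"
      by (simp add: bounded_linear.tendsto[OF bounded_linear_scaleC lim])
  qed
  then have "bounded_clinear (blinfun_apply L)"
    by (simp add: bounded_clinear_def blinfun.bounded_linear_right)
  then have "blinfun_of_cblinfun (CBlinfun (blinfun_apply L)) = L"
    by (intro blinfun_eqI) (simp add: blinfun_of_cblinfun.rep_eq CBlinfun_inverse)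
  then have "X \<longlonglongrightarrow> CBlinfun (blinfun_apply L)"
    using L by (simp add: tendsto_dist_iff[of _ L] tendsto_dist_iff[of _ "CBlinfun _"]
        flip: dist_blinfun_of_cblinfun)
  then show "convergent X"
    by (rule convergentI)
qed

lift_definition id_cblinfun :: "'a::complex_normed_vector \<Rightarrow>\<^sub>C\<^sub>L 'a" is "\<lambda>x. x"
  by (simp add: bounded_clinear_def)

lift_definition cblinfun_compose ::
  "('b::complex_normed_vector \<Rightarrow>\<^sub>C\<^sub>L 'c::complex_normed_vector) \<Rightarrow>
   ('a::complex_normed_vector \<Rightarrow>\<^sub>C\<^sub>L 'b) \<Rightarrow> 'a \<Rightarrow>\<^sub>C\<^sub>L 'c"  (infixl \<open>o\<^sub>C\<^sub>L\<close> 67)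
  is "\<lambda>f g x. f (g x)"
  by (simp add: bounded_clinear_def bounded_linear_compose)

lemma norm_cblinfun_compose: "norm (f o\<^sub>C\<^sub>L g) \<le> norm f * norm g"
  by transfer (simp add: bounded_clinear_def onorm_compose[unfolded o_def])


section \<open>Polaroid operators\<close>

definition spectrum :: "('a::cbanach \<Rightarrow>\<^sub>C\<^sub>L 'a) \<Rightarrow> complex set"
  where "spectrum T =
    {l. \<not> (\<exists>S. S o\<^sub>C\<^sub>L (T - l *\<^sub>C id_cblinfun) = id_cblinfun \<and>
              (T - l *\<^sub>C id_cblinfun) o\<^sub>C\<^sub>L S = id_cblinfun)}"

primrec cblinfun_power :: "('a::complex_normed_vector \<Rightarrow>\<^sub>C\<^sub>L 'a) \<Rightarrow> nat \<Rightarrow> 'a \<Rightarrow>\<^sub>C\<^sub>L 'a"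
  where
    "cblinfun_power T 0 = id_cblinfun"
  | "cblinfun_power T (Suc n) = T o\<^sub>C\<^sub>L cblinfun_power T n"

definition null_space :: "('a::complex_normed_vector \<Rightarrow>\<^sub>C\<^sub>L 'b::complex_normed_vector) \<Rightarrow> 'a set"
  where "null_space T = {x. cblinfun_apply T x = 0}"

definition range_space :: "('a::complex_normed_vector \<Rightarrow>\<^sub>C\<^sub>L 'b::complex_normed_vector) \<Rightarrow> 'b set"
  where "range_space T = range (cblinfun_apply T)"

text \<open>The infimum of the empty subset of \<^typ>\<open>enat\<close> is \<open>\<infinity>\<close>, so the two definitions below
  yield \<open>\<infinity>\<close> exactly if the chain of null spaces or ranges never stabilises.\<close>

definition ascent :: "('a::cbanach \<Rightarrow>\<^sub>C\<^sub>L 'a) \<Rightarrow> enat"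
  where "ascent T =
    Inf (enat ` {n. null_space (cblinfun_power T n) = null_space (cblinfun_power T (Suc n))})"

definition descent :: "('a::cbanach \<Rightarrow>\<^sub>C\<^sub>L 'a) \<Rightarrow> enat"
  where "descent T =
    Inf (enat ` {n. range_space (cblinfun_power T n) = range_space (cblinfun_power T (Suc n))})"

definition op_poles :: "('a::cbanach \<Rightarrow>\<^sub>C\<^sub>L 'a) \<Rightarrow> complex set"
  where "op_poles T = {l \<in> spectrum T.
    ascent (T - l *\<^sub>C id_cblinfun) = descent (T - l *\<^sub>C id_cblinfun) \<and>
    descent (T - l *\<^sub>C id_cblinfun) < \<infinity>}"

definition polaroid :: "('a::cbanach \<Rightarrow>\<^sub>C\<^sub>L 'a) \<Rightarrow> bool"
  where "polaroid T \<longleftrightarrow> {l. l isolated_in spectrum T} = op_poles T"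


section \<open>The generalized derivation\<close>

lift_definition generalized_derivation ::
  "('x::cbanach \<Rightarrow>\<^sub>C\<^sub>L 'x) \<Rightarrow> ('y::cbanach \<Rightarrow>\<^sub>C\<^sub>L 'y) \<Rightarrow> ('y \<Rightarrow>\<^sub>C\<^sub>L 'x) \<Rightarrow>\<^sub>C\<^sub>L ('y \<Rightarrow>\<^sub>C\<^sub>L 'x)"
  is "\<lambda>A B U. A o\<^sub>C\<^sub>L U - U o\<^sub>C\<^sub>L B"
proof -
  fix A :: "'x \<Rightarrow>\<^sub>C\<^sub>L 'x" and B :: "'y \<Rightarrow>\<^sub>C\<^sub>L 'y"
  have "bounded_linear (\<lambda>U. A o\<^sub>C\<^sub>L U - U o\<^sub>C\<^sub>L B)"
  proof (rule bounded_linear_intro)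
    show "A o\<^sub>C\<^sub>L (U + V) - (U + V) o\<^sub>C\<^sub>L B
        = (A o\<^sub>C\<^sub>L U - U o\<^sub>C\<^sub>L B) + (A o\<^sub>C\<^sub>L V - V o\<^sub>C\<^sub>L B)" for U V
      by transfer (auto simp: bounded_clinear_def linear_add bounded_linear.linear)
    show "A o\<^sub>C\<^sub>L (r *\<^sub>R U) - (r *\<^sub>R U) o\<^sub>C\<^sub>L B = r *\<^sub>R (A o\<^sub>C\<^sub>L U - U o\<^sub>C\<^sub>L B)" for r U
      by transfer (auto simp: bounded_clinear_def linear_cmul bounded_linear.linear algebra_simps)
    show "norm (A o\<^sub>C\<^sub>L U - U o\<^sub>C\<^sub>L B) \<le> norm U * (norm A + norm B)" for U
      using norm_triangle_ineq4[of "A o\<^sub>C\<^sub>L U" "U o\<^sub>C\<^sub>L B"]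
        norm_cblinfun_compose[of A U] norm_cblinfun_compose[of U B]
      by (simp add: algebra_simps)
  qed
  moreover have "A o\<^sub>C\<^sub>L (c *\<^sub>C U) - (c *\<^sub>C U) o\<^sub>C\<^sub>L B = c *\<^sub>C (A o\<^sub>C\<^sub>L U - U o\<^sub>C\<^sub>L B)" for c U
    by transfer (auto simp: bounded_clinear_def complex_vector.scale_right_diff_distrib)
  ultimately show "bounded_clinear (\<lambda>U. A o\<^sub>C\<^sub>L U - U o\<^sub>C\<^sub>L B)"
    by (simp add: bounded_clinear_def)
qed

end

(* Proof idea. A point is a pole of an operator iff the shifted operator is Drazin invertible, and Drazin
   invertibility forces the point to be isolated in the spectrum; so only the inclusion of the isolated
   points in the poles matters. The derivation is the difference of the commuting operators of left
   multiplication by A and right multiplication by B, and each difference of spectral values of A and B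
   is a spectral value of the derivation (rank-one operators built from approximate eigenvectors). Hence,
   for l isolated in the spectrum of the derivation, the set K of all g such that g is a spectral value
   of A and g - l one of B is finite and consists of isolated points, where A - g and B - (g - l) are
   Drazin invertible by assumption. Splitting off the points of K one at a time by spectral projections
   of A reduces the claim to disjoint spectra, where a Liouville argument (Rosenblum's theorem) shows
   that the difference is invertible. *)

theory Submission
  imports Defs "HOL-Complex_Analysis.Cauchy_Integral_Formula"
begin

section \<open>The Hahn--Banach theorem\<close>

text \<open>Kernels and ranges of powers of the derivation are not described in an evident way by
  those of \<open>A\<close> and \<open>B\<close>, so its ascent and descent are hard to reach
  directly. Drazin invertibility consists of ring equations instead: they survive the homomorphism
  \<open>left_mult\<close> and the antihomomorphism \<open>right_mult\<close>, and the spectral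
  projection becomes \<open>1 - t * s\<close> rather than a contour integral. What remains is
  algebra with idempotents plus analytic inputs. Rosenblum's theorem enters for a commuting pair in
  a Banach algebra. The open mapping theorem bounds the Drazin inverse of an operator with finite
  ascent and descent. For the differences of spectral values, approximate eigenvectors and
  approximate eigenfunctionals are both guaranteed only at frontier points of a spectrum; an
  arbitrary pair is therefore slid along \<open>a - b = l\<close> until one member lies on a
  frontier.\<close>

definition sublinear :: "('a::real_vector \<Rightarrow> real) \<Rightarrow> bool" where
  "sublinear q \<longleftrightarrow> (\<forall>x y. q (x + y) \<le> q x + q y) \<and> (\<forall>r x. 0 < r \<longrightarrow> q (r *\<^sub>R x) = r * q x) \<and> q 0 = 0"

lemma sublinear_add: "sublinear q \<Longrightarrow> q (x + y) \<le> q x + q y"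
  and sublinear_scale: "sublinear q \<Longrightarrow> 0 < r \<Longrightarrow> q (r *\<^sub>R x) = r * q x"
  and sublinear_zero: "sublinear q \<Longrightarrow> q 0 = 0"
  by (auto simp: sublinear_def)

lemma sublinear_minus: "sublinear q \<Longrightarrow> - q (- x) \<le> q x"
  using sublinear_add[of q x "- x"] by (simp add: sublinear_zero)

text \<open>An upper bound for scaling suffices: used with \<open>1 / r\<close> at
  \<open>r *\<^sub>R x\<close> it gives the reverse inequality.\<close>

lemma sublinearI:
  assumes "\<And>x y. q (x + y) \<le> q x + q y" "\<And>r x. 0 < r \<Longrightarrow> q (r *\<^sub>R x) \<le> r * q x" "q 0 = 0"
  shows "sublinear q"
  unfolding sublinear_def
proof (intro conjI allI impI assms antisym)
  fix r :: real and x assume r: "0 < r"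
  have "q ((1 / r) *\<^sub>R r *\<^sub>R x) \<le> (1 / r) * q (r *\<^sub>R x)"
    by (rule assms(2)) (use r in auto)
  with r show "r * q x \<le> q (r *\<^sub>R x)" by (simp add: field_simps)
qed

text \<open>Pushes \<open>q\<close> down until it is odd at \<open>v\<close>. Here \<open>q'\<close>
  is the infimal convolution of \<open>q\<close> with the functional on the ray through
  \<open>- v\<close> that sends \<open>- v\<close> to \<open>- q v\<close>: \<open>F x t\<close> is
  the cost of writing \<open>x\<close> as
  \<open>(x + t *\<^sub>R v) + t *\<^sub>R (- v)\<close>.\<close>

lemma sublinear_descend:
  assumes q: "sublinear q"
  shows "\<exists>q'. sublinear q' \<and> q' \<le> q \<and> q' (- v) \<le> - q v"
proof -
  define F where "F x t = q (x + t *\<^sub>R v) - t * q v" for x t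
  define q' where "q' x = (INF t\<in>{0..}. F x t)" for x
  have low: "- q (- x) \<le> F x t" if "0 \<le> t" for x t
  proof -
    have "q (t *\<^sub>R v) \<le> q (x + t *\<^sub>R v) + q (- x)"
      using sublinear_add[OF q, of "x + t *\<^sub>R v" "- x"] by simp
    moreover have "q (t *\<^sub>R v) = t * q v"
      using that q by (cases "t = 0") (auto simp: sublinear_zero sublinear_scale)
    ultimately show ?thesis by (simp add: F_def)
  qed
  have le: "q' x \<le> F x t" if "0 \<le> t" for x t
    unfolding q'_def using that low by (intro cINF_lower bdd_belowI2[of _ "- q (- x)"]) auto
  have ge: "m \<le> q' x" if "\<And>t. 0 \<le> t \<Longrightarrow> m \<le> F x t" for m x
    unfolding q'_def using that by (intro cINF_greatest) auto
  have "q' \<le> q"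
    using le[of 0] by (auto simp: le_fun_def F_def)
  moreover have "q' (- v) \<le> - q v"
    using le[of 1 "- v"] by (simp add: F_def sublinear_zero[OF q])
  moreover have "sublinear q'"
  proof (rule sublinearI)
    fix x y
    have "q' (x + y) - F y s \<le> F x t" if "0 \<le> s" "0 \<le> t" for s t
    proof -
      have "q' (x + y) \<le> F (x + y) (s + t)"
        by (rule le) (use that in simp)
      also have "\<dots> \<le> F x t + F y s"
        using sublinear_add[OF q, of "x + t *\<^sub>R v" "y + s *\<^sub>R v"]
        by (simp add: F_def algebra_simps)
      finally show ?thesis by simp
    qed
    then have "q' (x + y) - F y s \<le> q' x" if "0 \<le> s" for s
      using that by (intro ge) auto
    then have "q' (x + y) - q' x \<le> F y s" if "0 \<le> s" for s
      using that by (simp add: algebra_simps)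
    then show "q' (x + y) \<le> q' x + q' y"
      using ge[of "q' (x + y) - q' x" y] by simp
  next
    fix r :: real and x assume r: "0 < r"
    have "q' (r *\<^sub>R x) / r \<le> F x t" if "0 \<le> t" for t
    proof -
      have "q' (r *\<^sub>R x) \<le> F (r *\<^sub>R x) (r * t)"
        by (rule le) (use that r in simp)
      also have "\<dots> = r * F x t"
        using sublinear_scale[OF q r, of "x + t *\<^sub>R v"] by (simp add: F_def algebra_simps)
      finally show ?thesis using r by (simp add: field_simps)
    qed
    from ge[OF this] show "q' (r *\<^sub>R x) \<le> r * q' x" using r by (simp add: field_simps)
  next
    show "q' 0 = 0"
      using le[of 0 0] ge[of 0 0] low[of _ 0] by (auto simp: F_def sublinear_zero[OF q])
  qed
  ultimately show ?thesis by blast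
qed

text \<open>Zorn's lemma for the reversed order. The pointwise infimum of a chain is finite because
  each member \<open>q\<close> satisfies \<open>- p (- x) \<le> q x\<close>, and it is subadditive
  because of any two members of the chain one lies below the other.\<close>

lemma sublinear_minimal:
  assumes p: "sublinear p"
  obtains q where "sublinear q" "q \<le> p" "\<And>q'. sublinear q' \<Longrightarrow> q' \<le> q \<Longrightarrow> q' = q"
proof -
  define S where "S = {q. sublinear q \<and> q \<le> p}"
  have "\<exists>m\<in>S. \<forall>a\<in>S. a \<le> m \<longrightarrow> a = m"
  proof (rule predicate_Zorn)
    show "partial_order_on S (relation_of (\<lambda>a b. b \<le> a) S)"
      by (rule partial_order_on_relation_ofI) auto
  next
    fix C assume C: "C \<in> Chains (relation_of (\<lambda>a b. b \<le> a) S)"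
    have CS: "C \<subseteq> S"
      using C by (auto simp: Chains_def relation_of_def)
    have tot: "a \<le> b \<or> b \<le> a" if "a \<in> C" "b \<in> C" for a b
      using C that by (auto simp: Chains_def relation_of_def)
    show "\<exists>u\<in>S. \<forall>a\<in>C. u \<le> a"
    proof (cases "C = {}")
      case True
      with p show ?thesis by (auto simp: S_def)
    next
      case False
      define u where "u x = (INF q\<in>C. q x)" for x
      have subl: "sublinear q" "q \<le> p" if "q \<in> C" for q
        using CS that by (auto simp: S_def)
      have low: "- p (- x) \<le> q x" if "q \<in> C" for q x
        using sublinear_minus[OF subl(1)[OF that], of x] subl(2)[OF that]
        by (auto simp: le_fun_def intro: order_trans dest: spec[of _ "- x"])
      have le: "u x \<le> q x" if "q \<in> C" for q x
        unfolding u_def using that low by (intro cINF_lower bdd_belowI2[of _ "- p (- x)"]) auto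
      have ge: "m \<le> u x" if "\<And>q. q \<in> C \<Longrightarrow> m \<le> q x" for m x
        unfolding u_def using that False by (intro cINF_greatest) auto
      have "sublinear u"
      proof (rule sublinearI)
        fix x y
        have "u (x + y) - q2 y \<le> q1 x" if q12: "q1 \<in> C" "q2 \<in> C" for q1 q2
        proof -
          obtain q where q: "q \<in> C" "q \<le> q1" "q \<le> q2"
            using tot[OF q12] q12 by blast
          have "u (x + y) \<le> q (x + y)" by (rule le[OF q(1)])
          also have "\<dots> \<le> q x + q y" by (rule sublinear_add[OF subl(1)[OF q(1)]])
          also have "\<dots> \<le> q1 x + q2 y" using q(2,3) by (intro add_mono) (auto simp: le_fun_def)
          finally show ?thesis by simp
        qed
        then have "u (x + y) - q2 y \<le> u x" if "q2 \<in> C" for q2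
          using that by (intro ge) auto
        then have "u (x + y) - u x \<le> q2 y" if "q2 \<in> C" for q2
          using that by (simp add: algebra_simps)
        then show "u (x + y) \<le> u x + u y"
          using ge[of "u (x + y) - u x" y] by simp
      next
        fix r :: real and x assume r: "0 < r"
        have "u (r *\<^sub>R x) / r \<le> q x" if "q \<in> C" for q
          using le[OF that, of "r *\<^sub>R x"] sublinear_scale[OF subl(1)[OF that] r, of x] r
          by (simp add: field_simps)
        from ge[OF this] show "u (r *\<^sub>R x) \<le> r * u x" using r by (simp add: field_simps)
      next
        have "(\<lambda>q. q 0) ` C = {0}"
          using False subl(1) by (auto simp: sublinear_zero image_iff)
        then show "u 0 = 0" by (simp add: u_def)
      qed
      moreover have "u \<le> p"
      proof -
        obtain q where "q \<in> C" using False by blast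
        then show ?thesis using le[of q] subl(2)[of q] by (auto simp: le_fun_def intro: order_trans)
      qed
      ultimately show ?thesis using le by (auto simp: S_def le_fun_def)
    qed
  qed
  then obtain m where "m \<in> S" and min: "\<And>a. a \<in> S \<Longrightarrow> a \<le> m \<Longrightarrow> a = m" by blast
  then show thesis
    using that[of m] by (fastforce simp: S_def intro: order_trans)
qed

text \<open>A minimal sublinear functional is odd by \<open>sublinear_descend\<close>, hence linear.\<close>

lemma sublinear_minimal_linear:
  assumes q: "sublinear q" and min: "\<And>q'. sublinear q' \<Longrightarrow> q' \<le> q \<Longrightarrow> q' = q"
  shows "linear q"
proof -
  have odd: "q (- v) = - q v" for v
  proof -
    obtain q' where "sublinear q'" "q' \<le> q" "q' (- v) \<le> - q v"
      using sublinear_descend[OF q] by blast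
    with min have "q (- v) \<le> - q v" by metis
    with sublinear_minus[OF q, of "- v"] show ?thesis by simp
  qed
  show ?thesis
  proof (rule linearI)
    fix x y
    show "q (x + y) = q x + q y"
      using sublinear_add[OF q, of x y] sublinear_add[OF q, of "- x" "- y"] odd
      by (smt (verit) add.commute minus_add_distrib add_uminus_conv_diff)
  next
    fix r :: real and x
    consider "r = 0" | "0 < r" | "0 < - r" by linarith
    then show "q (r *\<^sub>R x) = r *\<^sub>R q x"
    proof cases
      case 3
      then have "q ((- r) *\<^sub>R x) = (- r) * q x" by (rule sublinear_scale[OF q])
      then show ?thesis using odd[of "r *\<^sub>R x"] by simp
    qed (auto simp: sublinear_zero[OF q] sublinear_scale[OF q])
  qed
qed

text \<open>Descending once at \<open>v\<close> before minimizing fixes the value at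
  \<open>v\<close>: every linear \<open>L\<close> below the result satisfies
  \<open>L (- v) \<le> - p v\<close>, hence \<open>p v \<le> L v\<close>.\<close>

lemma hahn_banach_real:
  assumes p: "sublinear p"
  obtains L where "linear L" "L \<le> p" "L v = p v"
proof -
  obtain q where q: "sublinear q" "q \<le> p" "q (- v) \<le> - p v"
    using sublinear_descend[OF p] by blast
  obtain L where L: "sublinear L" "L \<le> q" "\<And>q'. sublinear q' \<Longrightarrow> q' \<le> L \<Longrightarrow> q' = L"
    using sublinear_minimal[OF q(1)] by blast
  have lin: "linear L" using L by (intro sublinear_minimal_linear) auto
  have "L (- v) \<le> - p v" using L(2) q(3) by (auto simp: le_fun_def intro: order_trans)
  then have "p v \<le> L v" using linear_neg[OF lin, of v] by simp
  moreover have "L \<le> p" using L(2) q(2) by (rule order_trans)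
  ultimately show thesis using that[OF lin] by (simp add: le_fun_def antisym)
qed

text \<open>A complex linear functional is determined by its real part through
  \<open>f x = L x - i L (i x)\<close>. Rotating \<open>f x\<close> onto the positive real axis,
  where it equals its real part, yields the bound; at \<open>v\<close> the real part already
  exhausts this bound, so the imaginary part vanishes.\<close>

theorem hahn_banach_seminorm:
  fixes p :: "'a::complex_vector \<Rightarrow> real"
  assumes add: "\<And>x y. p (x + y) \<le> p x + p y" and scale: "\<And>c x. p (c *\<^sub>C x) = cmod c * p x"
  obtains f where "\<And>x y. f (x + y) = f x + f y" "\<And>c x. f (c *\<^sub>C x) = c * f x"
    "\<And>x. cmod (f x) \<le> p x" "f v = complex_of_real (p v)"
proof -
  have scaleR: "p (r *\<^sub>R x) = \<bar>r\<bar> * p x" for r x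
    using scale[of "complex_of_real r" x] by (simp add: scaleC_of_real)
  have "p 0 = 0" using scaleR[of 0 0] by simp
  with add scaleR have "sublinear p" by (intro sublinearI) auto
  then obtain L where L: "linear L" "L \<le> p" "L v = p v" by (rule hahn_banach_real)
  define f where "f x = Complex (L x) (- L (\<i> *\<^sub>C x))" for x
  have fadd: "f (x + y) = f x + f y" for x y
    by (simp add: f_def scaleC_add_right linear_add[OF L(1)] complex_eq_iff)
  have scaleC_Complex: "c *\<^sub>C x = Re c *\<^sub>R x + Im c *\<^sub>R \<i> *\<^sub>C x" for c and x :: 'a
  proof -
    have "c *\<^sub>C x = (of_real (Re c) + of_real (Im c) * \<i>) *\<^sub>C x"
      by (simp add: complex_eq mult.commute)
    then show ?thesis
      by (simp only: scaleC_add_left scaleC_of_real flip: scaleC_scaleC)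
  qed
  have ii: "\<i> *\<^sub>C \<i> *\<^sub>C x = - x" for x :: 'a
    by (simp add: scaleC_scaleC scaleC_one)
  have iR: "\<i> *\<^sub>C r *\<^sub>R x = r *\<^sub>R \<i> *\<^sub>C x" for r and x :: 'a
    by (simp add: scaleC_scaleC mult.commute flip: scaleC_of_real)
  have fscale: "f (c *\<^sub>C x) = c * f x" for c x
    by (subst scaleC_Complex[of c x])
      (simp add: f_def scaleC_add_right iR ii linear_add[OF L(1)] linear_cmul[OF L(1)]
        linear_neg[OF L(1)] linear_diff[OF L(1)] complex_eq_iff)
  have bound: "cmod (f x) \<le> p x" for x
  proof (cases "f x = 0")
    case True
    then show ?thesis using add[of x "- x"] scaleR[of "- 1" x] \<open>p 0 = 0\<close> by simp
  next
    case False
    define c where "c = cnj (f x) / cmod (f x)"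
    have c: "c * f x = cmod (f x)" "cmod c = 1"
      using False by (simp_all add: c_def norm_divide complex_norm_square[symmetric] power2_eq_square mult.commute)
    have "cmod (f x) = Re (f (c *\<^sub>C x))"
      by (simp add: fscale c)
    also have "\<dots> \<le> p (c *\<^sub>C x)" using L(2) by (simp add: f_def le_fun_def)
    finally show ?thesis by (simp add: scale c)
  qed
  have "f v = complex_of_real (p v)"
  proof -
    have "Re (f v) = p v" by (simp add: f_def L(3))
    moreover have "Im (f v) = 0"
      using bound[of v] \<open>Re (f v) = p v\<close> cmod_power2[of "f v"]
      by (smt (verit) norm_ge_zero power2_less_eq_zero_iff power_mono zero_le_power2)
    ultimately show ?thesis by (simp add: complex_eq_iff)
  qed
  with fadd fscale bound show thesis by (rule that)
qed

section \<open>Functionals and rank-one operators\<close>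

text \<open>Makes a functional a special case of a bounded operator, so that norms, composition and
  completeness are shared.\<close>

instantiation complex :: cbanach
begin

definition scaleC_complex :: "complex \<Rightarrow> complex \<Rightarrow> complex"
  where scaleC_complex [simp]: "scaleC_complex a x = a * x"

instance
  by standard (simp_all add: algebra_simps norm_mult scaleR_conv_of_real)

end

lemma bounded_clinear_cblinfun_apply: "bounded_clinear (cblinfun_apply T)"
  using cblinfun_apply[of T] by simp

lemma bounded_linear_cblinfun_apply: "bounded_linear (cblinfun_apply T)"
  using bounded_clinear_cblinfun_apply[of T] by (simp add: bounded_clinear_def)

lemma cblinfun_scaleC_right: "cblinfun_apply T (c *\<^sub>C x) = c *\<^sub>C cblinfun_apply T x"
  using bounded_clinear_cblinfun_apply[of T] by (simp add: bounded_clinear_def)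

lemmas cblinfun_linear = bounded_linear.linear[OF bounded_linear_cblinfun_apply]

lemmas cblinfun_right_simps =
  linear_add[OF cblinfun_linear] linear_diff[OF cblinfun_linear] linear_neg[OF cblinfun_linear]
  linear_0[OF cblinfun_linear] linear_cmul[OF cblinfun_linear] cblinfun_scaleC_right

lemmas cblinfun_left_simps =
  plus_cblinfun.rep_eq minus_cblinfun.rep_eq uminus_cblinfun.rep_eq zero_cblinfun.rep_eq
  scaleC_cblinfun.rep_eq scaleR_cblinfun.rep_eq id_cblinfun.rep_eq cblinfun_compose.rep_eq

lemma norm_cblinfun: "norm (cblinfun_apply T x) \<le> norm T * norm x"
  by (simp add: norm_cblinfun.rep_eq onorm bounded_linear_cblinfun_apply)

lemma norm_cblinfun_bound:
  "0 \<le> b \<Longrightarrow> (\<And>x. norm (cblinfun_apply T x) \<le> b * norm x) \<Longrightarrow> norm T \<le> b"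
  by (simp add: norm_cblinfun.rep_eq onorm_bound)

lemma norm_cblinfun_witness:
  assumes "0 \<le> b" "b < norm T"
  obtains x where "b * norm x < norm (cblinfun_apply T x)" "x \<noteq> 0"
proof -
  obtain x where x: "b * norm x < norm (cblinfun_apply T x)"
    using norm_cblinfun_bound[OF assms(1)] assms(2) by (meson not_le)
  moreover have "x \<noteq> 0" using x by (auto simp: cblinfun_right_simps)
  ultimately show thesis by (rule that)
qed

lemma cblinfun_apply_CBlinfun:
  assumes "\<And>x y. f (x + y) = f x + f y" "\<And>c x. f (c *\<^sub>C x) = c *\<^sub>C f x"
    "\<And>x. norm (f x) \<le> b * norm x"
  shows "cblinfun_apply (CBlinfun f) = f"
proof -
  have "f (r *\<^sub>R x) = r *\<^sub>R f x" for r x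
    using assms(2)[of "of_real r"] by (simp add: scaleC_of_real)
  then have "bounded_linear f"
    using assms by (intro bounded_linear_intro[of f b]) (auto simp: mult.commute)
  then show ?thesis by (intro CBlinfun_inverse) (simp add: bounded_clinear_def assms)
qed

text \<open>The distance \<open>p\<close> to the subspace \<open>M\<close> is a seminorm that
  vanishes on \<open>M\<close>, is at most the norm, and is at least \<open>d\<close> at
  \<open>v\<close>; a functional dominated by \<open>p\<close> with value \<open>p v\<close> at
  \<open>v\<close> separates.\<close>

lemma hahn_banach_dist:
  fixes M :: "'a::complex_normed_vector set"
  assumes M: "M \<noteq> {}" "\<And>x y. x \<in> M \<Longrightarrow> y \<in> M \<Longrightarrow> x + y \<in> M" "\<And>c x. x \<in> M \<Longrightarrow> c *\<^sub>C x \<in> M"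
    and d: "0 < d" "\<And>m. m \<in> M \<Longrightarrow> d \<le> norm (v - m)"
  obtains f :: "'a \<Rightarrow>\<^sub>C\<^sub>L complex" where "\<And>m. m \<in> M \<Longrightarrow> cblinfun_apply f m = 0"
    "cblinfun_apply f v \<noteq> 0"
proof -
  define p where "p x = (INF m\<in>M. norm (x - m))" for x
  have le: "p x \<le> norm (x - m)" if "m \<in> M" for x m
    unfolding p_def using that by (intro cINF_lower bdd_belowI2[of _ 0]) auto
  have ge: "b \<le> p x" if "\<And>m. m \<in> M \<Longrightarrow> b \<le> norm (x - m)" for b x
    unfolding p_def using that M(1) by (intro cINF_greatest) auto
  have nonneg: "0 \<le> p x" for x by (rule ge) simp
  have M0: "0 \<in> M" using M(1) M(3)[of _ 0] by auto
  have "p (x + y) \<le> p x + p y" for x y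
  proof -
    have "p (x + y) - norm (y - n) \<le> norm (x - m)" if "m \<in> M" "n \<in> M" for m n
      using le[OF M(2)[OF that], of "x + y"] norm_triangle_ineq[of "x - m" "y - n"]
      by (simp add: algebra_simps)
    then have "p (x + y) - norm (y - n) \<le> p x" if "n \<in> M" for n
      using that by (intro ge) auto
    then have "p (x + y) - p x \<le> norm (y - n)" if "n \<in> M" for n
      using that by (simp add: algebra_simps)
    then show ?thesis using ge[of "p (x + y) - p x" y] by simp
  qed
  moreover have "p (c *\<^sub>C x) = cmod c * p x" for c x
  proof (cases "c = 0")
    case True
    then show ?thesis using le[OF M0, of 0] nonneg[of 0] by simp
  next
    case False
    have half: "p (c *\<^sub>C x) \<le> cmod c * p x" if "c \<noteq> 0" for c x
    proof -
      have "p (c *\<^sub>C x) / cmod c \<le> norm (x - m)" if "m \<in> M" for m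
      proof -
        have "p (c *\<^sub>C x) \<le> norm (c *\<^sub>C (x - m))"
          using le[OF M(3)[OF that, of c], of "c *\<^sub>C x"]
          by (simp add: complex_vector.scale_right_diff_distrib)
        then have "p (c *\<^sub>C x) \<le> cmod c * norm (x - m)" by (simp only: norm_scaleC)
        then show ?thesis using \<open>c \<noteq> 0\<close> by (simp add: field_simps)
      qed
      from ge[OF this] show ?thesis using that by (simp add: field_simps)
    qed
    have "p x \<le> cmod (1 / c) * p (c *\<^sub>C x)"
      using half[of "1 / c" "c *\<^sub>C x"] False by (simp add: scaleC_scaleC scaleC_one)
    with half[OF False, of x] False show ?thesis
      by (simp add: norm_divide field_simps)
  qed
  ultimately obtain f where f: "\<And>x y. f (x + y) = f x + f y" "\<And>c x. f (c *\<^sub>C x) = c * f x"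
    "\<And>x. cmod (f x) \<le> p x" "f v = complex_of_real (p v)"
    by (rule hahn_banach_seminorm) blast
  have "cblinfun_apply (CBlinfun f) = f"
    by (rule cblinfun_apply_CBlinfun[of f 1]) (use f order_trans[OF f(3) le[OF M0]] in auto)
  moreover have "f m = 0" if "m \<in> M" for m
    using order_trans[OF f(3) le[OF that], of m] by simp
  moreover have "f v \<noteq> 0" using f(4) ge[OF d(2)] d(1) by simp
  ultimately show thesis by (intro that[of "CBlinfun f"]) auto
qed

lemma norming_functional:
  fixes v :: "'a::complex_normed_vector"
  obtains f :: "'a \<Rightarrow>\<^sub>C\<^sub>L complex" where "norm f \<le> 1" "cblinfun_apply f v = norm v"
proof -
  obtain f :: "'a \<Rightarrow> complex" where f: "\<And>x y. f (x + y) = f x + f y"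
    "\<And>c x. f (c *\<^sub>C x) = c * f x" "\<And>x. cmod (f x) \<le> norm x" "f v = norm v"
    by (rule hahn_banach_seminorm[of norm v]) (auto intro: norm_triangle_ineq norm_scaleC)
  have ap: "cblinfun_apply (CBlinfun f) = f"
    by (rule cblinfun_apply_CBlinfun[of f 1]) (use f in auto)
  with f show thesis by (intro that[of "CBlinfun f"] norm_cblinfun_bound) auto
qed

lift_definition rank_one ::
  "'x::complex_normed_vector \<Rightarrow> ('y::complex_normed_vector \<Rightarrow>\<^sub>C\<^sub>L complex) \<Rightarrow> 'y \<Rightarrow>\<^sub>C\<^sub>L 'x"
  is "\<lambda>x f y. f y *\<^sub>C x"
proof -
  fix x :: 'x and f :: "'y \<Rightarrow> complex"
  assume f: "bounded_clinear f"
  have "bounded_linear f" using f by (simp add: bounded_clinear_def)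
  note lin = bounded_linear.linear[OF this]
  have "bounded_linear (\<lambda>y. f y *\<^sub>C x)"
  proof (intro bounded_linear_intro[of _ "onorm f * norm x"])
    fix y
    show "norm (f y *\<^sub>C x) \<le> norm y * (onorm f * norm x)"
      using mult_right_mono[OF onorm[OF \<open>bounded_linear f\<close>, of y], of "norm x"]
      by (simp add: norm_scaleC mult_ac)
    show "f (r *\<^sub>R y) *\<^sub>C x = r *\<^sub>R f y *\<^sub>C x" for r
      by (simp only: linear_cmul[OF lin] scaleR_conv_of_real flip: scaleC_scaleC)
        (simp only: scaleC_of_real)
  qed (simp add: linear_add[OF lin] scaleC_add_left)
  then show "bounded_clinear (\<lambda>y. f y *\<^sub>C x)"
    using f by (simp add: bounded_clinear_def scaleC_scaleC)
qed

lemma norm_rank_one: "norm (rank_one x f) = norm x * norm f"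
proof (rule antisym)
  show "norm (rank_one x f) \<le> norm x * norm f"
  proof (rule norm_cblinfun_bound)
    show "norm (cblinfun_apply (rank_one x f) y) \<le> norm x * norm f * norm y" for y
      using mult_left_mono[OF norm_cblinfun[of f y], of "norm x"]
      by (simp add: rank_one.rep_eq norm_scaleC mult.commute mult.left_commute)
  qed simp
  have "norm f \<le> norm (rank_one x f) / norm x" if "x \<noteq> 0"
  proof (rule norm_cblinfun_bound)
    show "norm (cblinfun_apply f y) \<le> norm (rank_one x f) / norm x * norm y" for y
      using norm_cblinfun[of "rank_one x f" y] that
      by (simp add: rank_one.rep_eq norm_scaleC field_simps)
  qed simp
  then show "norm x * norm f \<le> norm (rank_one x f)"
    by (cases "x = 0") (auto simp: field_simps)
qed

section \<open>Invertible elements and spectra in Banach algebras\<close>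

text \<open>The sort \<open>{ring, monoid_mult}\<close> describes rings with a unit that are allowed to be trivial;
  \<^class>\<open>ring_1\<close> would exclude the operators on the zero space.\<close>

definition unit_elem :: "'a::{ring,monoid_mult} \<Rightarrow> bool" where
  "unit_elem x \<longleftrightarrow> (\<exists>y. y * x = 1 \<and> x * y = 1)"

definition unit_inv :: "'a::{ring,monoid_mult} \<Rightarrow> 'a" where
  "unit_inv x = (SOME y. y * x = 1 \<and> x * y = 1)"

lemma unit_inv:
  assumes "unit_elem x"
  shows "unit_inv x * x = 1" "x * unit_inv x = 1"
  using someI_ex[OF assms[unfolded unit_elem_def]] by (simp_all add: unit_inv_def)

lemma unit_elemI: "y * x = 1 \<Longrightarrow> x * y = 1 \<Longrightarrow> unit_elem x"
  by (auto simp: unit_elem_def)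

lemma unit_elemI_one_sided:
  assumes "y * x = 1" "x * z = 1"
  shows "unit_elem x"
proof -
  have "y = y * (x * z)" by (simp add: assms)
  also have "\<dots> = y * x * z" by (simp only: mult.assoc)
  finally have "y = z" by (simp add: assms)
  then show ?thesis using assms by (intro unit_elemI[of y]) auto
qed

lemma commute_unit_inv:
  fixes x :: "'a::{ring,monoid_mult}"
  assumes "unit_elem x" "c * x = x * c"
  shows "c * unit_inv x = unit_inv x * c"
proof -
  have "c * unit_inv x = unit_inv x * (x * c) * unit_inv x"
    by (simp add: unit_inv[OF assms(1)] flip: mult.assoc)
  also have "\<dots> = unit_inv x * c"
    by (simp add: unit_inv[OF assms(1)] mult.assoc flip: assms(2))
  finally show ?thesis .
qed

lemma unit_elem_of_commuting_product:
  fixes x :: "'a::{ring,monoid_mult}"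
  assumes "unit_elem (x * y)" "x * y = y * x"
  shows "unit_elem x"
proof (rule unit_elemI_one_sided)
  show "unit_inv (x * y) * y * x = 1"
    using unit_inv(1)[OF assms(1)] by (simp only: mult.assoc assms(2))
  show "x * (y * unit_inv (x * y)) = 1"
    using unit_inv(2)[OF assms(1)] by (simp only: mult.assoc)
qed

lemma unit_elem_mult:
  fixes x :: "'a::{ring,monoid_mult}"
  assumes "unit_elem x" "unit_elem y"
  shows "unit_elem (x * y)"
proof (rule unit_elemI[of "unit_inv y * unit_inv x"])
  show "unit_inv y * unit_inv x * (x * y) = 1"
    using unit_inv[OF assms(1)] unit_inv[OF assms(2)] by (metis mult.assoc mult_1)
  show "x * y * (unit_inv y * unit_inv x) = 1"
    using unit_inv[OF assms(1)] unit_inv[OF assms(2)] by (metis mult.assoc mult_1)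
qed

lemma one_minus_geometric_sum:
  fixes x :: "'a::{ring,monoid_mult}"
  shows "(1 - x) * (\<Sum>i<n. x ^ i) = 1 - x ^ n" "(\<Sum>i<n. x ^ i) * (1 - x) = 1 - x ^ n"
proof -
  show "(1 - x) * (\<Sum>i<n. x ^ i) = 1 - x ^ n"
    by (induction n) (simp_all add: distrib_left left_diff_distrib)
  show "(\<Sum>i<n. x ^ i) * (1 - x) = 1 - x ^ n"
    by (induction n)
      (simp_all add: distrib_right right_diff_distrib power_commutes, simp add: algebra_simps)
qed

lemma unit_elem_one_minus_nilpotent:
  fixes x :: "'a::{ring,monoid_mult}"
  shows "x ^ n = 0 \<Longrightarrow> unit_elem (1 - x)"
  by (intro unit_elemI[of "\<Sum>i<n. x ^ i"]) (simp_all add: one_minus_geometric_sum)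

text \<open>The class \<open>real_normed_algebra_1\<close> would demand \<open>norm 1 = 1\<close>
  and exclude the trivial algebra. This is why the estimates below carry an explicit factor
  \<open>norm 1\<close>.\<close>

class cbanach_algebra = cbanach + real_normed_algebra + monoid_mult +
  assumes mult_scaleC_left: "(c *\<^sub>C x) * y = c *\<^sub>C (x * y)"
    and mult_scaleC_right: "x * (c *\<^sub>C y) = c *\<^sub>C (x * y)"

lemmas scaleC_simps =
  scaleC_add_right scaleC_add_left scaleC_scaleC scaleC_one mult_scaleC_left mult_scaleC_right
  complex_vector.scale_right_diff_distrib complex_vector.scale_left_diff_distrib

text \<open>Neumann series: the partial geometric sums, multiplied by \<open>1 - x\<close> on either
  side, tend to 1.\<close>

lemma unit_elem_one_minus:
  fixes x :: "'a::cbanach_algebra"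
  assumes x: "norm x < 1"
  shows "unit_elem (1 - x)"
proof -
  have pow: "norm (x ^ n) \<le> norm (1::'a) * norm x ^ n" for n
  proof (induction n)
    case (Suc n)
    have "norm (x ^ Suc n) \<le> norm x * norm (x ^ n)"
      by (simp add: norm_mult_ineq)
    also have "\<dots> \<le> norm x * (norm (1::'a) * norm x ^ n)"
      by (intro mult_left_mono Suc) simp
    finally show ?case by (simp add: mult_ac)
  qed simp
  have "summable (\<lambda>n. norm (1::'a) * norm x ^ n)"
    using x by (intro summable_mult summable_geometric) simp
  then have summ: "summable (\<lambda>n. x ^ n)"
    by (rule summable_comparison_test'[of _ 0]) (use pow in auto)
  then have lim: "(\<lambda>n. \<Sum>i<n. x ^ i) \<longlonglongrightarrow> (\<Sum>n. x ^ n)"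
    by (rule summable_LIMSEQ)
  have "(\<lambda>n. 1 - x ^ n) \<longlonglongrightarrow> 1 - 0"
    by (intro tendsto_intros summable_LIMSEQ_zero summ)
  moreover have "(\<lambda>n. 1 - x ^ n) \<longlonglongrightarrow> (1 - x) * (\<Sum>n. x ^ n)"
    using tendsto_mult[OF tendsto_const lim, of "1 - x"] by (simp add: one_minus_geometric_sum)
  moreover have "(\<lambda>n. 1 - x ^ n) \<longlonglongrightarrow> (\<Sum>n. x ^ n) * (1 - x)"
    using tendsto_mult[OF lim tendsto_const, of "1 - x"] by (simp add: one_minus_geometric_sum)
  ultimately show ?thesis
    by (intro unit_elemI[of "\<Sum>n. x ^ n"]) (metis LIMSEQ_unique diff_zero)+
qed

lemma unit_elem_perturb:
  fixes x y :: "'a::cbanach_algebra"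
  assumes "unit_elem x" "norm (unit_inv x * y) < 1"
  shows "unit_elem (x - y)"
proof -
  have "x - y = x * (1 - unit_inv x * y)"
    by (simp add: right_diff_distrib unit_inv[OF assms(1)] flip: mult.assoc)
  then show ?thesis
    using assms by (simp add: unit_elem_mult unit_elem_one_minus)
qed

section \<open>Spectrum and resolvent\<close>

definition alg_spectrum :: "'a::cbanach_algebra \<Rightarrow> complex set" where
  "alg_spectrum a = {l. \<not> unit_elem (a - l *\<^sub>C 1)}"

abbreviation resolvent :: "'a::cbanach_algebra \<Rightarrow> complex \<Rightarrow> 'a" where
  "resolvent a l \<equiv> unit_inv (a - l *\<^sub>C 1)"

lemma resolvent:
  assumes "l \<notin> alg_spectrum a"
  shows "resolvent a l * (a - l *\<^sub>C 1) = 1" "(a - l *\<^sub>C 1) * resolvent a l = 1"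
  using assms by (simp_all add: alg_spectrum_def unit_inv)

text \<open>Otherwise \<open>a - l\<close> would be a small perturbation of the unit
  \<open>a - m\<close>. The estimate gives both the openness of the resolvent set and the growth of
  the resolvent near the spectrum.\<close>

lemma norm_resolvent_ge:
  assumes "l \<in> alg_spectrum a" "m \<notin> alg_spectrum a"
  shows "1 \<le> cmod (m - l) * norm (resolvent a m)"
proof (rule ccontr)
  assume "\<not> ?thesis"
  then have "norm (resolvent a m * ((l - m) *\<^sub>C 1)) < 1"
    by (simp add: mult_scaleC_right norm_scaleC norm_minus_commute)
  moreover have "unit_elem (a - m *\<^sub>C 1)" using assms by (simp add: alg_spectrum_def)
  ultimately have "unit_elem (a - m *\<^sub>C 1 - (l - m) *\<^sub>C 1)"
    by (rule unit_elem_perturb[rotated])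
  then show False
    using assms(1) by (simp add: alg_spectrum_def complex_vector.scale_left_diff_distrib)
qed

lemma open_alg_resolvent_set: "open (- alg_spectrum a)"
proof (rule openI)
  fix m assume m: "m \<in> - alg_spectrum a"
  \<comment> \<open>The summand 1 keeps the radius positive even if the resolvent is 0, as in the
    trivial algebra.\<close>
  define e where "e = 1 / (norm (resolvent a m) + 1)"
  have e: "0 < e" by (simp add: e_def add_nonneg_pos)
  have "l \<notin> alg_spectrum a" if "dist m l < e" for l
  proof
    assume "l \<in> alg_spectrum a"
    then have "1 \<le> cmod (m - l) * norm (resolvent a m)"
      using m by (intro norm_resolvent_ge) auto
    also have "\<dots> \<le> e * norm (resolvent a m)"
      using that by (intro mult_right_mono) (simp_all add: dist_norm)
    also have "\<dots> < 1"
      by (simp add: e_def divide_less_eq add_nonneg_pos)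
    finally show False by simp
  qed
  then show "\<exists>e>0. ball m e \<subseteq> - alg_spectrum a"
    using e by (intro exI[of _ e]) auto
qed

lemma closed_alg_spectrum: "closed (alg_spectrum a)"
  using open_alg_resolvent_set by (simp add: closed_def)

lemma alg_spectrum_norm_le:
  fixes a :: "'a::cbanach_algebra"
  assumes "l \<in> alg_spectrum a"
  shows "cmod l \<le> norm a"
proof (rule ccontr)
  assume l: "\<not> ?thesis"
  then have l0: "l \<noteq> 0" by auto
  have "norm ((1 / l) *\<^sub>C a) < 1"
    using l by (simp add: norm_scaleC norm_divide divide_simps)
  then have "unit_elem (1 - (1 / l) *\<^sub>C a)" by (rule unit_elem_one_minus)
  moreover have "unit_elem ((- l) *\<^sub>C (1::'a))"
    by (rule unit_elemI[of "(- 1 / l) *\<^sub>C 1"]) (use l0 in \<open>simp_all add: scaleC_simps\<close>)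
  ultimately have "unit_elem ((- l) *\<^sub>C 1 * (1 - (1 / l) *\<^sub>C a))"
    by (intro unit_elem_mult)
  moreover have "(- l) *\<^sub>C 1 * (1 - (1 / l) *\<^sub>C a) = a - l *\<^sub>C 1"
    using l0 by (simp add: scaleC_simps)
  ultimately show False using assms by (simp add: alg_spectrum_def)
qed

lemma resolvent_identity:
  assumes "l \<notin> alg_spectrum a" "m \<notin> alg_spectrum a"
  shows "resolvent a l - resolvent a m = (l - m) *\<^sub>C (resolvent a l * resolvent a m)"
proof -
  have "resolvent a l - resolvent a m
      = resolvent a l * ((a - m *\<^sub>C 1) * resolvent a m)
        - (resolvent a l * (a - l *\<^sub>C 1)) * resolvent a m"
    by (simp add: resolvent assms)
  also have "\<dots> = resolvent a l * ((a - m *\<^sub>C 1) - (a - l *\<^sub>C 1)) * resolvent a m"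
    by (simp only: mult.assoc right_diff_distrib left_diff_distrib)
  also have "(a - m *\<^sub>C 1) - (a - l *\<^sub>C 1) = (l - m) *\<^sub>C 1"
    by (simp add: scaleC_simps)
  finally show ?thesis by (simp only: mult_scaleC_left mult_scaleC_right mult_1_right)
qed

text \<open>The resolvent identity bounds the difference by a multiple of the still uncontrolled
  norm at \<open>l\<close>. Once \<open>cmod (l - m) * N < 1 / 2\<close>, that term is absorbed, the
  norm at \<open>l\<close> is at most \<open>2 * N\<close>, and the identity gives a Lipschitz
  bound.\<close>

lemma resolvent_continuous:
  assumes m: "m \<notin> alg_spectrum a"
  shows "(resolvent a \<longlongrightarrow> resolvent a m) (at m)"
proof -
  define N where "N = norm (resolvent a m)"
  have ev: "eventually (\<lambda>l. l \<notin> alg_spectrum a) (at m)"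
    using eventually_at_topological m open_alg_resolvent_set by (metis ComplD ComplI)
  have "((\<lambda>l. cmod (l - m) * N) \<longlongrightarrow> cmod (m - m) * N) (at m)"
    by (intro tendsto_intros)
  then have ev2: "eventually (\<lambda>l. cmod (l - m) * N < 1 / 2) (at m)"
    by (rule order_tendstoD) simp
  have "eventually (\<lambda>l. norm (resolvent a l - resolvent a m) \<le> cmod (l - m) * (2 * N * N)) (at m)"
    using ev ev2
  proof eventually_elim
    case (elim l)
    let ?n = "norm (resolvent a l)"
    have le: "norm (resolvent a l - resolvent a m) \<le> cmod (l - m) * (?n * N)"
      unfolding resolvent_identity[OF elim(1) m] norm_scaleC N_def
      by (intro mult_left_mono norm_mult_ineq) simp
    have "?n \<le> N + cmod (l - m) * (?n * N)"
      using norm_triangle_sub[of "resolvent a l" "resolvent a m"] le by (simp add: N_def)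
    also have "cmod (l - m) * (?n * N) \<le> (1 / 2) * ?n"
      using mult_right_mono[of "cmod (l - m) * N" "1 / 2" ?n] elim(2) by (simp add: mult_ac)
    finally have "?n \<le> 2 * N" by simp
    then have "cmod (l - m) * (?n * N) \<le> cmod (l - m) * (2 * N * N)"
      by (intro mult_left_mono mult_right_mono) (simp_all add: N_def)
    with le show ?case by simp
  qed
  moreover have "((\<lambda>l. cmod (l - m) * (2 * N * N)) \<longlongrightarrow> 0) (at m)"
    by (rule tendsto_eq_intros | simp)+
  ultimately have "((\<lambda>l. resolvent a l - resolvent a m) \<longlongrightarrow> 0) (at m)"
    by (rule Lim_null_comparison)
  then show ?thesis by (simp add: LIM_zero_iff)
qed

text \<open>Testing against functionals reduces everything to scalar complex analysis; by the
  resolvent identity the difference quotient is the value of \<open>f\<close> at the product of two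
  resolvents.\<close>

lemma resolvent_holomorphic:
  fixes f :: "'a::cbanach_algebra \<Rightarrow>\<^sub>C\<^sub>L complex"
  shows "(\<lambda>l. cblinfun_apply f (resolvent a l)) holomorphic_on (- alg_spectrum a)"
proof -
  have "((\<lambda>l. cblinfun_apply f (resolvent a l)) has_field_derivative
      cblinfun_apply f (resolvent a m * resolvent a m)) (at m)"
    if m: "m \<notin> alg_spectrum a" for m
  proof -
    have ev: "eventually (\<lambda>l. l \<notin> alg_spectrum a) (at m)"
      using eventually_at_topological m open_alg_resolvent_set by (metis ComplD ComplI)
    have "((\<lambda>l. cblinfun_apply f (resolvent a l * resolvent a m))
        \<longlongrightarrow> cblinfun_apply f (resolvent a m * resolvent a m)) (at m)"
      by (intro bounded_linear.tendsto[OF bounded_linear_cblinfun_apply] tendsto_mult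
          resolvent_continuous m tendsto_const)
    moreover have "eventually (\<lambda>l. cblinfun_apply f (resolvent a l * resolvent a m) =
        (cblinfun_apply f (resolvent a l) - cblinfun_apply f (resolvent a m)) / (l - m)) (at m)"
      using ev eventually_neq_at_within[of m]
    proof eventually_elim
      case (elim l)
      have "cblinfun_apply f (resolvent a l) - cblinfun_apply f (resolvent a m)
          = (l - m) * cblinfun_apply f (resolvent a l * resolvent a m)"
        using resolvent_identity[OF elim(1) m]
        by (simp flip: cblinfun_right_simps add: cblinfun_scaleC_right)
      then show ?case using elim(2) by simp
    qed
    ultimately show ?thesis
      unfolding has_field_derivative_iff by (rule Lim_transform_eventually)
  qed
  then show ?thesis
    by (auto simp: holomorphic_on_open open_alg_resolvent_set)
qed

text \<open>Decay at infinity, read off from \<open>l R = a R - 1\<close> for the resolvent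
  \<open>R\<close> at \<open>l\<close>.\<close>

lemma norm_resolvent_le:
  fixes a :: "'a::cbanach_algebra"
  assumes "norm a < cmod l"
  shows "norm (resolvent a l) * (cmod l - norm a) \<le> norm (1::'a)"
proof -
  have l: "l \<notin> alg_spectrum a" using alg_spectrum_norm_le[of l a] assms by auto
  have "l *\<^sub>C resolvent a l = a * resolvent a l - 1"
    using resolvent(2)[OF l] by (simp add: left_diff_distrib mult_scaleC_left algebra_simps)
  then have "cmod l * norm (resolvent a l) \<le> norm (a * resolvent a l) + norm (1::'a)"
    using norm_triangle_ineq4[of "a * resolvent a l" 1] by (simp flip: norm_scaleC)
  also have "\<dots> \<le> norm a * norm (resolvent a l) + norm (1::'a)"
    by (intro add_right_mono norm_mult_ineq)
  finally have "cmod l * norm (resolvent a l) \<le> norm a * norm (resolvent a l) + norm (1::'a)" .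
  then show ?thesis by (simp add: algebra_simps)
qed

text \<open>If \<open>a - b\<close> were not invertible, some functional would vanish on its multiples but not at \<open>1\<close>.
  It identifies the resolvents of \<open>a\<close> and \<open>b\<close>, and the resulting function would be entire and
  vanish at infinity.\<close>

theorem unit_elem_diff:
  fixes a b :: "'a::cbanach_algebra"
  assumes comm: "a * b = b * a" and disj: "alg_spectrum a \<inter> alg_spectrum b = {}"
  shows "unit_elem (a - b)"
proof (rule ccontr)
  assume contr: "\<not> ?thesis"
  define T where "T = a - b"
  define M where "M = {T * c |c. c * T = T * c}"
  have dist: "1 \<le> norm (1 - m)" if m: "m \<in> M" for m
  proof (rule ccontr)
    assume "\<not> ?thesis"
    then have "unit_elem (1 - (1 - m))" by (intro unit_elem_one_minus) simp
    moreover obtain c where "m = T * c" "c * T = T * c" using m unfolding M_def by blast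
    ultimately have "unit_elem T" using unit_elem_of_commuting_product[of T c] by (metis add_diff_cancel_left' diff_diff_eq2)
    then show False using contr by (simp add: T_def)
  qed
  have add: "x + y \<in> M" if xy: "x \<in> M" "y \<in> M" for x y
  proof -
    obtain c d where "x = T * c" "c * T = T * c" "y = T * d" "d * T = T * d"
      using xy unfolding M_def by blast
    then have "x + y = T * (c + d) \<and> (c + d) * T = T * (c + d)"
      by (simp only: distrib_left distrib_right simp_thms)
    then show ?thesis unfolding M_def by blast
  qed
  have scale: "c *\<^sub>C x \<in> M" if x: "x \<in> M" for c x
  proof -
    obtain d where "x = T * d" "d * T = T * d" using x unfolding M_def by blast
    then have "c *\<^sub>C x = T * (c *\<^sub>C d) \<and> (c *\<^sub>C d) * T = T * (c *\<^sub>C d)"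
      by (simp only: mult_scaleC_left mult_scaleC_right simp_thms)
    then show ?thesis unfolding M_def by blast
  qed
  have ne: "M \<noteq> {}" by (auto simp: M_def intro!: exI[of _ 0])
  obtain f :: "'a \<Rightarrow>\<^sub>C\<^sub>L complex"
    where f0: "\<And>m. m \<in> M \<Longrightarrow> cblinfun_apply f m = 0" and f1: "cblinfun_apply f 1 \<noteq> 0"
    using hahn_banach_dist[OF ne add scale zero_less_one dist] by metis
  \<comment> \<open>Glues the two resolvent functions. By \<open>h_b\<close> the branches agree
    wherever both resolvents exist, and disjointness of the spectra makes the two domains cover the
    plane.\<close>
  define h where "h l = (if l \<in> alg_spectrum a then cblinfun_apply f (resolvent b l)
    else cblinfun_apply f (resolvent a l))" for l
  have h_b: "h l = cblinfun_apply f (resolvent b l)" if lb: "l \<notin> alg_spectrum b" for l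
  proof (cases "l \<in> alg_spectrum a")
    case False
    let ?ra = "resolvent a l" and ?rb = "resolvent b l"
    have ua: "unit_elem (a - l *\<^sub>C 1)" and ub: "unit_elem (b - l *\<^sub>C 1)"
      using False lb by (simp_all add: alg_spectrum_def)
    have TA: "T * (a - l *\<^sub>C 1) = (a - l *\<^sub>C 1) * T"
      by (simp add: T_def left_diff_distrib right_diff_distrib scaleC_simps comm)
    have TB: "T * (b - l *\<^sub>C 1) = (b - l *\<^sub>C 1) * T"
      by (simp add: T_def left_diff_distrib right_diff_distrib scaleC_simps comm)
    have Ta: "T * ?ra = ?ra * T" and Tb: "T * ?rb = ?rb * T"
      using commute_unit_inv[OF ua TA] commute_unit_inv[OF ub TB] by auto
    \<comment> \<open>The difference of the resolvents is a multiple of \<open>T = a - b\<close>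
      with a commuting cofactor, hence killed by \<open>f\<close>.\<close>
    have "?rb - ?ra = ?ra * (a - l *\<^sub>C 1) * ?rb - ?ra * ((b - l *\<^sub>C 1) * ?rb)"
      by (simp add: unit_inv[OF ua] unit_inv[OF ub])
    also have "\<dots> = ?ra * ((a - l *\<^sub>C 1) - (b - l *\<^sub>C 1)) * ?rb"
      by (simp only: mult.assoc right_diff_distrib left_diff_distrib)
    also have "\<dots> = ?ra * T * ?rb" by (simp add: T_def)
    also have "\<dots> = T * (?ra * ?rb)" by (simp add: mult.assoc flip: Ta)
    finally have "?rb - ?ra = T * (?ra * ?rb)" .
    moreover have "(?ra * ?rb) * T = T * (?ra * ?rb)"
      by (metis Ta Tb mult.assoc)
    ultimately have "?rb - ?ra \<in> M" unfolding M_def by blast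
    then have "cblinfun_apply f ?rb - cblinfun_apply f ?ra = 0"
      using f0 by (simp flip: cblinfun_right_simps)
    then show ?thesis using False by (simp add: h_def)
  qed (simp add: h_def)
  have "h holomorphic_on (- alg_spectrum a \<union> - alg_spectrum b)"
  proof (rule holomorphic_on_Un)
    show "h holomorphic_on - alg_spectrum a"
      using resolvent_holomorphic by (rule holomorphic_transform) (simp add: h_def)
    show "h holomorphic_on - alg_spectrum b"
      using resolvent_holomorphic by (rule holomorphic_transform) (simp add: h_b)
  qed (rule open_alg_resolvent_set)+
  moreover have "- alg_spectrum a \<union> - alg_spectrum b = UNIV" using disj by auto
  ultimately have hol: "h holomorphic_on UNIV" by simp
  have h_le: "cmod (h l) * (cmod l - norm a) \<le> norm f * norm (1::'a)" if "norm a < cmod l" for l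
  proof -
    have "l \<notin> alg_spectrum a" using alg_spectrum_norm_le[of l a] that by auto
    then have "cmod (h l) \<le> norm f * norm (resolvent a l)" by (simp add: h_def norm_cblinfun)
    then have "cmod (h l) * (cmod l - norm a) \<le> norm f * norm (resolvent a l) * (cmod l - norm a)"
      using that by (intro mult_right_mono) auto
    also have "\<dots> \<le> norm f * norm (1::'a)"
      using mult_left_mono[OF norm_resolvent_le[OF that], of "norm f"] by (simp add: mult.assoc)
    finally show ?thesis .
  qed
  have "(h \<longlongrightarrow> 0) at_infinity"
  proof (rule Lim_null_comparison)
    have "eventually (\<lambda>l. norm a + 1 \<le> cmod l) at_infinity"
      by (auto simp: eventually_at_infinity)
    then show "eventually (\<lambda>l. cmod (h l) \<le> norm f * norm (1::'a) / (cmod l - norm a)) at_infinity"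
    proof eventually_elim
      case (elim l)
      then show ?case using h_le[of l] by (simp add: divide_simps)
    qed
    have "filterlim (\<lambda>l. - norm a + cmod l) at_top at_infinity"
      by (rule filterlim_tendsto_add_at_top[OF tendsto_const filterlim_norm_at_top])
    then show "((\<lambda>l. norm f * norm (1::'a) / (cmod l - norm a)) \<longlongrightarrow> 0) at_infinity"
      by (intro real_tendsto_divide_at_top[OF tendsto_const]) simp
  qed
  then have h0: "h l = 0" for l using Liouville_weak[OF hol] by blast
  \<comment> \<open>From \<open>h l = 0\<close> and \<open>l R = a R - 1\<close> it follows that
    \<open>f 1 = f (a R)\<close>, which tends to 0 as \<open>l\<close> grows. \<open>K\<close> is
    chosen so that at \<open>cmod l = norm a + 1 + K\<close> this reads
    \<open>cmod (f 1) * (1 + K) \<le> cmod (f 1) * K\<close>.\<close>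
  define K where "K = norm f * norm a * norm (1::'a) / cmod (cblinfun_apply f 1)"
  define l where "l = complex_of_real (norm a + 1 + K)"
  have "0 \<le> K" by (simp add: K_def)
  then have cl: "cmod l = norm a + 1 + K"
    unfolding l_def norm_of_real by simp
  then have la: "norm a < cmod l" using \<open>0 \<le> K\<close> by simp
  then have ls: "l \<notin> alg_spectrum a" using alg_spectrum_norm_le[of l a] by auto
  have "l *\<^sub>C resolvent a l = a * resolvent a l - 1"
    using resolvent(2)[OF ls] by (simp add: left_diff_distrib mult_scaleC_left algebra_simps)
  then have "cblinfun_apply f (l *\<^sub>C resolvent a l)
      = cblinfun_apply f (a * resolvent a l) - cblinfun_apply f 1"
    by (simp only: cblinfun_right_simps)
  then have "cblinfun_apply f (a * resolvent a l) - cblinfun_apply f 1 = l * h l"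
    using ls by (simp add: h_def cblinfun_scaleC_right)
  then have "cmod (cblinfun_apply f 1) = cmod (cblinfun_apply f (a * resolvent a l))"
    by (simp add: h0)
  also have "\<dots> \<le> norm f * (norm a * norm (resolvent a l))"
    by (rule order_trans[OF norm_cblinfun]) (simp add: mult_left_mono norm_mult_ineq)
  finally have "cmod (cblinfun_apply f 1) * (1 + K)
      \<le> norm f * norm a * (norm (resolvent a l) * (cmod l - norm a))"
    using \<open>0 \<le> K\<close> mult_right_mono[of "cmod (cblinfun_apply f 1)" _ "1 + K"]
    by (simp add: cl mult_ac)
  also have "\<dots> \<le> norm f * norm a * norm (1::'a)"
    by (intro mult_left_mono norm_resolvent_le la) simp
  also have "\<dots> = cmod (cblinfun_apply f 1) * K" using f1 by (simp add: K_def)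
  finally show False using f1 by simp
qed

section \<open>Drazin invertible elements\<close>

text \<open>The number \<open>k\<close> is any exponent that works and need not be the least one,
  the Drazin index.\<close>

definition drazin_inverse :: "'a::{ring,monoid_mult} \<Rightarrow> 'a \<Rightarrow> nat \<Rightarrow> bool" where
  "drazin_inverse t s k \<longleftrightarrow> t * s = s * t \<and> s * t * s = s \<and> t ^ Suc k * s = t ^ k"

definition drazin :: "'a::{ring,monoid_mult} \<Rightarrow> bool" where
  "drazin t \<longleftrightarrow> (\<exists>s k. drazin_inverse t s k)"

lemma drazinI: "drazin_inverse t s k \<Longrightarrow> drazin t"
  by (auto simp: drazin_def)

lemma unit_elem_drazin: "unit_elem t \<Longrightarrow> drazin t"
  by (rule drazinI[of _ "unit_inv t" 0]) (simp add: drazin_inverse_def unit_inv)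

section \<open>Powers of commuting elements\<close>

lemma commute_power:
  fixes c t :: "'a::{ring,monoid_mult}"
  assumes "c * t = t * c"
  shows "c * t ^ n = t ^ n * c"
proof (induction n)
  case (Suc n)
  have "c * t ^ Suc n = (c * t) * t ^ n" by (simp add: mult.assoc)
  also have "\<dots> = t * (c * t ^ n)" by (simp only: assms mult.assoc)
  also have "\<dots> = t ^ Suc n * c" by (simp add: Suc mult.assoc)
  finally show ?case .
qed simp

lemma commuting_power_mult:
  fixes x y :: "'a::{ring,monoid_mult}"
  assumes "x * y = y * x"
  shows "(x * y) ^ n = x ^ n * y ^ n"
proof (induction n)
  case (Suc n)
  have "(x * y) ^ Suc n = x * (y * x ^ n) * y ^ n" by (simp add: Suc mult.assoc)
  also have "y * x ^ n = x ^ n * y" using assms by (intro commute_power) simp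
  finally show ?case by (simp add: mult.assoc)
qed simp

text \<open>Replaces the binomial expansion: peeling one factor off \<open>(x + y) ^ (a + b)\<close>
  leaves \<open>x * z\<close> and \<open>y * z\<close>, for which one power of \<open>x\<close> or
  of \<open>y\<close> less is enough. The factor \<open>z\<close> allows nilpotency that holds only
  in the corner of an idempotent.\<close>

lemma commuting_power_add:
  fixes x y z :: "'a::{ring,monoid_mult}"
  assumes comm: "x * y = y * x" and "x ^ a * z = 0" "y ^ b * z = 0"
  shows "(x + y) ^ (a + b) * z = 0"
  using assms(2-)
proof (induction "a + b" arbitrary: a b z)
  case 0
  then show ?case by simp
next
  case (Suc n)
  show ?case
  proof (cases "a = 0 \<or> b = 0")
    case True
    then have "z = 0" using Suc.prems by auto
    then show ?thesis by simp
  next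
    case False
    then obtain a' b' where ab: "a = Suc a'" "b = Suc b'" by (metis not0_implies_Suc)
    have "y ^ b * (x * z) = x * (y ^ b * z)" "x ^ a * (y * z) = y * (x ^ a * z)"
      using commute_power[OF comm, of b] commute_power[OF comm[symmetric], of a]
      by (simp_all flip: mult.assoc)
    moreover have "x ^ a' * (x * z) = 0" "y ^ b' * (y * z) = 0"
      using Suc.prems by (simp_all add: ab power_commutes flip: mult.assoc)
    ultimately have "(x + y) ^ (a' + b) * (x * z) = 0" "(x + y) ^ (a + b') * (y * z) = 0"
      using Suc.prems Suc.hyps(2) Suc.hyps(1)[of a' b "x * z"] Suc.hyps(1)[of a b' "y * z"]
      by (simp_all add: ab del: power_Suc)
    moreover have "(x + y) ^ (a + b) * z
        = (x + y) ^ (a' + b) * (x * z) + (x + y) ^ (a + b') * (y * z)"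
      using ab power_Suc2[of "x + y" "a' + b"] by (simp add: mult.assoc distrib_left distrib_right)
    ultimately show ?thesis by simp
  qed
qed

lemma minus_power_eq_0:
  fixes x :: "'a::{ring,monoid_mult}"
  assumes "x ^ n = 0"
  shows "(- x) ^ n = 0"
proof -
  have "(- x) ^ n = x ^ n \<or> (- x) ^ n = - (x ^ n)" by (induction n) auto
  then show ?thesis using assms by auto
qed

text \<open>\<open>p\<close> is the spectral idempotent of \<open>t\<close> at 0: \<open>t\<close>
  is nilpotent in the corner of \<open>p\<close> and has the inverse \<open>s\<close> in the corner
  of \<open>1 - p\<close>.\<close>

lemma drazin_projection:
  assumes "drazin_inverse t s k"
  defines "p \<equiv> 1 - t * s"
  shows "p * p = p" "t * p = p * t" "s * p = 0" "p * s = 0" "t ^ k * p = 0" "t * s = 1 - p"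
    "s * t = 1 - p"
proof -
  have st: "s * t = t * s" and sts: "s * t * s = s" and k: "t ^ Suc k * s = t ^ k"
    using assms(1) by (auto simp: drazin_inverse_def)
  have st': "s * (t * x) = t * (s * x)" for x
    by (simp only: st flip: mult.assoc)
  have tss: "t * (s * s) = s" using sts by (simp add: st mult.assoc)
  have tk: "t ^ k * (t * s) = t ^ k"
    using k unfolding power_Suc2 mult.assoc .
  show "t * p = p * t" "s * p = 0" "p * s = 0" "t ^ k * p = 0" "t * s = 1 - p" "s * t = 1 - p"
    "p * p = p"
    by (simp_all add: p_def left_diff_distrib right_diff_distrib mult.assoc st st' tss tk)
qed

text \<open>The exponent is \<open>Suc k\<close> because the zeroth power would be 1 when
  \<open>k = 0\<close>.\<close>

lemma drazin_nilpotent_part: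
  assumes dr: "drazin_inverse t s k"
  shows "(t * (1 - t * s)) ^ Suc k = 0"
proof -
  define p where "p = 1 - t * s"
  note p = drazin_projection[OF dr, folded p_def]
  have pp: "p ^ Suc m = p" for m by (induction m) (simp_all add: p(1))
  have "t ^ Suc k * p = 0" using p(5) by (simp add: mult.assoc)
  then show ?thesis unfolding commuting_power_mult[OF p(2), folded p_def] pp p_def[symmetric] .
qed

text \<open>The Drazin inverse lies in the double commutant. Since
  \<open>1 - p = s ^ n * t ^ n\<close> and \<open>t ^ n * p = 0\<close>, moving \<open>c\<close>
  past \<open>t ^ n\<close> annihilates \<open>(1 - p) * c * p\<close>, and symmetrically
  \<open>p * c * (1 - p)\<close>. So \<open>c\<close> commutes with \<open>p\<close>, and then with
  \<open>s\<close> because \<open>s = s * t * s\<close>.\<close>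

lemma drazin_inverse_commute:
  assumes dr: "drazin_inverse t s k" and c: "c * t = t * c"
  shows "c * s = s * c"
proof -
  define p where "p = 1 - t * s"
  note p = drazin_projection[OF dr, folded p_def]
  define n where "n = Suc k"
  have pp: "(1 - p) * (1 - p) = 1 - p"
    by (simp add: left_diff_distrib right_diff_distrib p(1))
  have pow: "(1 - p) ^ Suc m = 1 - p" for m
    by (induction m) (simp_all add: pp)
  have e1: "t ^ n * s ^ n = 1 - p"
    using commuting_power_mult[of t s n] pow[of k] p(6,7) by (simp add: n_def)
  have e2: "s ^ n * t ^ n = 1 - p"
    using commuting_power_mult[of s t n] pow[of k] p(6,7) by (simp add: n_def)
  have tp: "t ^ n * p = 0" by (simp add: n_def p(5) mult.assoc)
  have pt: "p * t ^ n = 0" using tp commute_power[OF p(2)[symmetric], of n] by simp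
  have cn: "c * t ^ n = t ^ n * c" by (rule commute_power[OF c])
  have "(1 - p) * c * p = s ^ n * (c * (t ^ n * p))"
    by (simp add: mult.assoc cn flip: e2) (simp add: cn flip: mult.assoc)
  then have 1: "c * p = p * c * p" by (simp add: tp left_diff_distrib)
  have "p * c * (1 - p) = (p * t ^ n) * c * s ^ n"
    by (simp add: mult.assoc flip: e1) (simp add: cn flip: mult.assoc)
  then have "p * c = p * c * p" by (simp add: pt right_diff_distrib)
  with 1 have pc: "p * c = c * p" by simp
  have "c * s = c * ((1 - p) * s)" by (simp add: left_diff_distrib p(4))
  also have "\<dots> = (s * t) * c * s"
    by (simp add: p(7) left_diff_distrib right_diff_distrib pc flip: mult.assoc)
  also have "\<dots> = s * (c * t) * s" by (simp add: c mult.assoc)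
  also have "\<dots> = s * c * (1 - p)" by (simp add: mult.assoc p(6))
  also have "\<dots> = s * (1 - p) * c"
    by (simp add: left_diff_distrib right_diff_distrib mult.assoc pc)
  also have "\<dots> = s * c" by (simp add: right_diff_distrib p(3))
  finally show ?thesis .
qed

text \<open>The idempotent \<open>p\<close> of \<open>t\<close> also serves \<open>t + n\<close>. In
  the corner of \<open>1 - p\<close> the sum is \<open>t * (1 + s * n)\<close>, where the second
  factor is a unit, so \<open>s * u\<close> inverts it; in the corner of \<open>p\<close> it is a
  sum of commuting nilpotents.\<close>

lemma drazin_add_nilpotent:
  assumes dr: "drazin_inverse t s k" and tn: "n * t = t * n" and nil: "n ^ m = 0"
  shows "drazin (t + n)"
proof -
  define p where "p = 1 - t * s"
  note p = drazin_projection[OF dr, folded p_def]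
  have sn: "n * s = s * n" by (rule drazin_inverse_commute[OF dr tn])
  have pn: "p * n = n * p"
    by (simp add: p_def left_diff_distrib right_diff_distrib mult.assoc sn[symmetric])
      (simp add: tn flip: mult.assoc)
  have "(s * n) ^ m = 0" using commuting_power_mult[OF sn[symmetric]] nil by simp
  then have "(- (s * n)) ^ m = 0" by (rule minus_power_eq_0)
  from unit_elem_one_minus_nilpotent[OF this] have unit: "unit_elem (1 + s * n)" by simp
  define u where "u = unit_inv (1 + s * n)"
  have u: "u * (1 + s * n) = 1" "(1 + s * n) * u = 1"
    using unit_inv[OF unit] by (simp_all add: u_def)
  have su: "s * u = u * s" "p * u = u * p" "(t + n) * u = u * (t + n)"
  proof -
    show "s * u = u * s"
      unfolding u_def by (rule commute_unit_inv[OF unit])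
        (simp add: distrib_left distrib_right mult.assoc sn)
    show "p * u = u * p"
      unfolding u_def by (rule commute_unit_inv[OF unit])
        (simp add: distrib_left distrib_right mult.assoc pn[symmetric] p(3), simp add: p(3,4) flip: mult.assoc)
    show "(t + n) * u = u * (t + n)"
      unfolding u_def
    proof (rule commute_unit_inv[OF unit])
      have "t * (s * n) = (s * n) * t"
        by (simp add: mult.assoc tn) (simp add: p(6,7) flip: mult.assoc)
      moreover have "n * (s * n) = (s * n) * n" by (simp add: sn flip: mult.assoc)
      ultimately show "(t + n) * (1 + s * n) = (1 + s * n) * (t + n)"
        by (simp add: distrib_left distrib_right)
    qed
  qed
  have e: "(t + n) * (s * u) = 1 - p"
  proof -
    have "(1 - p) * (1 + s * n) = (t + n) * s"
      by (simp add: distrib_left distrib_right left_diff_distrib p(4,6) sn flip: mult.assoc)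
    then have "(t + n) * (s * u) = (1 - p) * ((1 + s * n) * u)"
      by (simp flip: mult.assoc)
    then show ?thesis by (simp add: u)
  qed
  have "(s * u) * (t + n) = s * (t + n) * u" by (simp add: mult.assoc su(3))
  also have "s * (t + n) = (t + n) * s" by (simp add: distrib_left distrib_right sn p(6,7))
  finally have e': "(s * u) * (t + n) = 1 - p" using e by (simp add: mult.assoc)
  have "(t + n) ^ (k + m) * p = 0"
    by (rule commuting_power_add) (simp_all add: tn p(5) nil)
  then have "(t + n) ^ (k + m) * ((t + n) * (s * u)) = (t + n) ^ (k + m)"
    by (simp add: e right_diff_distrib)
  then have "(t + n) ^ Suc (k + m) * (s * u) = (t + n) ^ (k + m)"
    by (simp add: power_Suc2 mult.assoc del: power_Suc)
  moreover have "(s * u) * (t + n) * (s * u) = s * u"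
    unfolding e' by (simp add: left_diff_distrib p(4) flip: mult.assoc)
  ultimately have "drazin_inverse (t + n) (s * u) (k + m)"
    unfolding drazin_inverse_def using e e' by simp
  then show ?thesis by (rule drazinI)
qed

text \<open>An idempotent \<open>p\<close> commuting with everything in sight splits the ring into two factors; equality
  of the first components of \<open>x\<close> and \<open>y\<close> is expressed by \<open>x * p = y * p\<close>.\<close>

lemma corner_mult:
  fixes p :: "'a::{ring,monoid_mult}"
  assumes "x * p = x' * p" "y * p = y' * p" "p * y' = y' * p"
  shows "(x * y) * p = (x' * y') * p"
proof -
  have "(x * y) * p = (x * p) * y'" by (simp add: mult.assoc assms(2,3))
  also have "\<dots> = (x' * y') * p" by (simp add: mult.assoc assms(1,3))
  finally show ?thesis .
qed

lemma corner_power: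
  fixes p :: "'a::{ring,monoid_mult}"
  assumes "x * p = x' * p" "p * x' = x' * p"
  shows "x ^ n * p = x' ^ n * p"
proof (induction n)
  case (Suc n)
  show ?case
    unfolding power_Suc2
    by (rule corner_mult[OF Suc assms])
qed simp

lemma corner_eqI:
  fixes p :: "'a::{ring,monoid_mult}"
  assumes "x * p = y * p" "x * (1 - p) = y * (1 - p)"
  shows "x = y"
proof -
  have "x = x * p + x * (1 - p)" by (simp add: right_diff_distrib)
  also have "\<dots> = y" unfolding assms by (simp add: right_diff_distrib)
  finally show ?thesis .
qed

text \<open>The last claim covers every \<open>n \<ge> k\<close> so that two corners with different
  exponents can share their maximum.\<close>

lemma corner_drazin_inverse:
  fixes p :: "'a::{ring,monoid_mult}"
  assumes "drazin_inverse t' s' k" "t * p = t' * p" "s * p = s' * p"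
    "p * t' = t' * p" "p * s' = s' * p"
  shows "(t * s) * p = (s * t) * p" "(s * t * s) * p = s * p"
    "n \<ge> k \<Longrightarrow> (t ^ Suc n * s) * p = t ^ n * p"
proof -
  have d: "t' * s' = s' * t'" "s' * t' * s' = s'" "t' ^ Suc k * s' = t' ^ k"
    using assms(1) by (simp_all add: drazin_inverse_def)
  show "(t * s) * p = (s * t) * p" "(s * t * s) * p = s * p"
    using corner_mult[OF assms(2,3,5)] corner_mult[OF assms(3,2,4)]
      corner_mult[OF corner_mult[OF assms(3,2,4)] assms(3,5)] d assms(3) by simp_all
  assume "n \<ge> k"
  then obtain j where n: "n = j + k" by (metis add.commute le_Suc_ex)
  have "(t ^ Suc n * s) * p = (t' ^ Suc n * s') * p"
    by (rule corner_mult[OF corner_power[OF assms(2,4)] assms(3,5)])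
  also have "t' ^ Suc n * s' = t' ^ j * (t' ^ Suc k * s')"
    by (simp only: n power_add mult.assoc flip: add_Suc_right)
  also have "\<dots> = t' ^ n" unfolding d n power_add ..
  finally show "(t ^ Suc n * s) * p = t ^ n * p"
    by (simp only: corner_power[OF assms(2,4)])
qed

text \<open>The elements \<open>t1\<close> and \<open>t2\<close> live in the whole ring and agree
  with \<open>t\<close> only on their own corner. Their Drazin inverses respect the splitting by the
  double commutant property, so \<open>s1 * p + s2 * q\<close> glues them.\<close>

lemma corner_drazin:
  fixes p :: "'a::{ring,monoid_mult}"
  assumes p: "p * p = p" and "drazin t1" "drazin t2"
    and t1: "t * p = t1 * p" "p * t1 = t1 * p"
    and t2: "t * (1 - p) = t2 * (1 - p)" "p * t2 = t2 * p"
  shows "drazin t"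
proof -
  obtain s1 k1 s2 k2 where d: "drazin_inverse t1 s1 k1" "drazin_inverse t2 s2 k2"
    using assms by (auto simp: drazin_def)
  have ps: "p * s1 = s1 * p" "p * s2 = s2 * p"
    using drazin_inverse_commute[OF d(1) t1(2)] drazin_inverse_commute[OF d(2) t2(2)] by auto
  define q where "q = 1 - p"
  have q: "q * t2 = t2 * q" "q * s2 = s2 * q" "t * q = t2 * q"
    using t2 ps by (simp_all add: q_def left_diff_distrib right_diff_distrib)
  define s where "s = s1 * p + s2 * q"
  have "s * p = s1 * p" "s * q = s2 * q"
    by (simp_all add: s_def q_def distrib_right mult.assoc left_diff_distrib right_diff_distrib p)
  note c1 = corner_drazin_inverse[OF d(1) t1(1) this(1) t1(2) ps(1)]
    and c2 = corner_drazin_inverse[OF d(2) q(3) this(2) q(1,2)]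
  have "drazin_inverse t s (max k1 k2)"
    unfolding drazin_inverse_def
    by (intro conjI; rule corner_eqI[of _ p, folded q_def]; rule c1 c2; simp)
  then show ?thesis by (rule drazinI)
qed

lemma corner_unit_elem:
  fixes p :: "'a::{ring,monoid_mult}"
  assumes p: "p * p = p" and u: "unit_elem t1" "unit_elem t2"
    and t1: "t * p = t1 * p" "p * t1 = t1 * p"
    and t2: "t * (1 - p) = t2 * (1 - p)" "p * t2 = t2 * p"
  shows "unit_elem t"
proof -
  let ?s1 = "unit_inv t1" and ?s2 = "unit_inv t2"
  have ps: "p * ?s1 = ?s1 * p" "p * ?s2 = ?s2 * p"
    using commute_unit_inv[OF u(1) t1(2)] commute_unit_inv[OF u(2) t2(2)] by auto
  define q where "q = 1 - p"
  have q: "q * t2 = t2 * q" "q * ?s2 = ?s2 * q" "t * q = t2 * q"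
    using t2 ps by (simp_all add: q_def left_diff_distrib right_diff_distrib)
  define s where "s = ?s1 * p + ?s2 * q"
  have s: "s * p = ?s1 * p" "s * q = ?s2 * q"
    by (simp_all add: s_def q_def distrib_right mult.assoc left_diff_distrib right_diff_distrib p)
  show ?thesis
  proof (rule unit_elemI[of s]; rule corner_eqI[of _ p, folded q_def])
    show "s * t * p = 1 * p" "t * s * p = 1 * p"
      using corner_mult[OF s(1) t1] corner_mult[OF t1(1) s(1) ps(1)] by (simp_all add: unit_inv u)
    show "s * t * q = 1 * q" "t * s * q = 1 * q"
      using corner_mult[OF s(2) q(3,1)] corner_mult[OF q(3) s(2) q(2)] by (simp_all add: unit_inv u)
  qed
qed

text \<open>Overwriting the nilpotent corner by the identity leaves only the invertible part of
  \<open>t\<close>; the inverse is \<open>s + p\<close>.\<close>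

lemma drazin_unit_part:
  assumes "drazin_inverse t s k"
  defines "p \<equiv> 1 - t * s"
  shows "unit_elem (t * (1 - p) + p)"
proof (rule unit_elemI)
  note p = drazin_projection[OF assms(1), folded p_def]
  show "(s + p) * (t * (1 - p) + p) = 1" "(t * (1 - p) + p) * (s + p) = 1"
    by (simp_all add: distrib_left distrib_right left_diff_distrib right_diff_distrib mult.assoc
        p(1,3,4) p(2)[symmetric]) (simp_all add: p(1-4,6,7) flip: mult.assoc)
qed

lemma unit_elem_scaleC:
  fixes x :: "'a::cbanach_algebra"
  assumes "unit_elem x" "c \<noteq> 0"
  shows "unit_elem (c *\<^sub>C x)"
  using assms
  by (intro unit_elemI[of "(1 / c) *\<^sub>C unit_inv x"]) (simp_all add: scaleC_simps unit_inv)

lemma unit_elem_one [simp]: "unit_elem 1"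
  by (rule unit_elemI[of 1]) simp_all

lemma idempotent_absorb:
  fixes p t :: "'a::{ring,monoid_mult}"
  shows "p * p = p \<Longrightarrow> t * p = p * t \<Longrightarrow> p * (t * p) = t * p"
  by (metis mult.assoc)

lemma commute_scaleC_one:
  fixes x :: "'a::cbanach_algebra"
  shows "x * (c *\<^sub>C 1) = (c *\<^sub>C 1) * x"
  by (simp add: scaleC_simps)

text \<open>In the corner of \<open>p\<close>, a nilpotent minus any nonzero scalar is invertible;
  in the other corner the unit \<open>t2\<close> tolerates small scalars.\<close>

lemma drazin_punctured_neighbourhood:
  fixes t :: "'a::cbanach_algebra"
  assumes "drazin t"
  shows "eventually (\<lambda>l. unit_elem (t - l *\<^sub>C 1)) (at 0)"
proof -
  obtain s k where dr: "drazin_inverse t s k" using assms by (auto simp: drazin_def)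
  define p where "p = 1 - t * s"
  note p = drazin_projection[OF dr, folded p_def]
  define t2 where "t2 = t * (1 - p) + p"
  have u2: "unit_elem t2" unfolding t2_def p_def by (rule drazin_unit_part[OF dr])
  have "((\<lambda>l. cmod l * norm (unit_inv t2)) \<longlongrightarrow> 0) (at 0)"
    by (rule tendsto_eq_intros | simp)+
  then have "eventually (\<lambda>l. cmod l * norm (unit_inv t2) < 1) (at 0)"
    by (rule order_tendstoD) simp
  with eventually_neq_at_within[of 0]
  show ?thesis
  proof eventually_elim
    case (elim l)
    have tp: "t * p = p * t" by (rule p)
    have nil: "(t * p) ^ Suc k = 0"
      unfolding p_def by (rule drazin_nilpotent_part[OF dr])
    have scale_pow: "(c *\<^sub>C x) ^ n = c ^ n *\<^sub>C x ^ n" for c n and x :: 'a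
      by (induction n) (simp_all add: scaleC_simps)
    have "((1 / l) *\<^sub>C (t * p)) ^ Suc k = 0"
      unfolding scale_pow nil by simp
    from unit_elem_one_minus_nilpotent[OF this]
    have "unit_elem ((- l) *\<^sub>C (1 - (1 / l) *\<^sub>C (t * p)))"
      using elim by (intro unit_elem_scaleC) auto
    then have 1: "unit_elem (t * p - l *\<^sub>C 1)"
      using elim by (simp add: scaleC_simps)
    have 2: "unit_elem (t2 - l *\<^sub>C 1)"
      by (rule unit_elem_perturb[OF u2]) (use elim in \<open>simp add: scaleC_simps norm_scaleC\<close>)
    show ?case
    proof (rule corner_unit_elem[OF p(1) 1 2])
      show "(t - l *\<^sub>C 1) * p = (t * p - l *\<^sub>C 1) * p"
        by (simp add: left_diff_distrib mult.assoc p(1))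
      show "p * (t * p - l *\<^sub>C 1) = (t * p - l *\<^sub>C 1) * p"
        by (simp add: left_diff_distrib right_diff_distrib scaleC_simps tp)
          (metis tp p(1) mult.assoc)
      show "(t - l *\<^sub>C 1) * (1 - p) = (t2 - l *\<^sub>C 1) * (1 - p)"
        by (simp add: t2_def left_diff_distrib right_diff_distrib distrib_left distrib_right
            scaleC_simps mult.assoc p(1))
      have "p * t2 = t2 * p"
        by (simp add: t2_def left_diff_distrib right_diff_distrib distrib_left distrib_right tp)
          (metis tp p(1) mult.assoc)
      then show "p * (t2 - l *\<^sub>C 1) = (t2 - l *\<^sub>C 1) * p"
        by (simp add: left_diff_distrib right_diff_distrib scaleC_simps)
    qed
  qed
qed

text \<open>Replacing \<open>a\<close> by a scalar \<open>c\<close> on the range of the projection \<open>p\<close> of \<open>a\<close> at \<open>g\<close> removes \<open>g\<close> from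
  the spectrum of \<open>a\<close>; on the range of \<open>p\<close> itself \<open>b - a\<close> differs from \<open>b - g\<close> by a commuting
  nilpotent. The case \<open>K = {}\<close> is \<open>unit_elem_diff\<close>.\<close>

theorem drazin_diff:
  fixes a b :: "'a::cbanach_algebra"
  assumes "finite K" "a * b = b * a" "alg_spectrum a \<inter> alg_spectrum b \<subseteq> K"
    and "\<And>g. g \<in> K \<Longrightarrow> drazin (a - g *\<^sub>C 1)" "\<And>g. g \<in> K \<Longrightarrow> drazin (b - g *\<^sub>C 1)"
  shows "drazin (b - a)"
  using assms
proof (induction K arbitrary: a rule: finite_induct)
  case empty
  then have "unit_elem (b - a)" by (intro unit_elem_diff) auto
  then show ?case by (rule unit_elem_drazin)
next
  case (insert g K)
  obtain s k where dr: "drazin_inverse (a - g *\<^sub>C 1) s k"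
    using insert.prems(3)[of g] by (auto simp: drazin_def)
  define t where "t = a - g *\<^sub>C 1"
  note dr = dr[folded t_def]
  have a_t: "a = t + g *\<^sub>C 1" by (simp add: t_def)
  define p where "p = 1 - t * s"
  note p = drazin_projection[OF dr, folded p_def]
  have tp: "t * p = p * t" by (rule p)
  have ap: "p * a = a * p" by (simp add: a_t distrib_left distrib_right tp scaleC_simps)
  have bt: "b * t = t * b"
    by (simp add: t_def left_diff_distrib right_diff_distrib insert.prems(1) scaleC_simps)
  have bs: "b * s = s * b" by (rule drazin_inverse_commute[OF dr bt])
  have pb: "p * b = b * p"
  proof -
    have "b * (t * s) = t * s * b" by (metis bt bs mult.assoc)
    then show ?thesis by (simp add: p_def left_diff_distrib right_diff_distrib)
  qed
  \<comment> \<open>Outside the ball, \<open>c\<close> is no spectral value of \<open>b\<close>, so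
    putting it into the spectrum of \<open>a'\<close> creates no new common value. Outside
    \<open>K\<close>, it makes \<open>c - l\<close> nonzero for every \<open>l\<close> in
    \<open>K\<close>.\<close>
  have "bounded (cball 0 (norm b) \<union> insert g K)"
    using insert.hyps by (simp add: finite_imp_bounded)
  then obtain c where c: "c \<notin> cball 0 (norm b) \<union> insert g K"
    using not_bounded_UNIV by (metis UNIV_eq_I)
  have cb: "c \<notin> alg_spectrum b" using c alg_spectrum_norm_le[of c b] by auto
  define a' where "a' = a * (1 - p) + c *\<^sub>C p"
  have a'p: "(a' - l *\<^sub>C 1) * p = ((c - l) *\<^sub>C 1) * p" for l
    by (simp add: a'_def left_diff_distrib right_diff_distrib distrib_right scaleC_simps mult.assoc p(1))
  have a'q: "(a' - l *\<^sub>C 1) * (1 - p) = (a - l *\<^sub>C 1) * (1 - p)" for l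
    by (simp add: a'_def left_diff_distrib right_diff_distrib distrib_left distrib_right
        scaleC_simps mult.assoc p(1))
  have pl: "p * (x - l *\<^sub>C 1) = (x - l *\<^sub>C 1) * p" if "p * x = x * p" for x l
    by (simp add: left_diff_distrib right_diff_distrib scaleC_simps that)
  have comm: "a' * b = b * a'"
  proof -
    have "a * p * b = b * (a * p)" by (metis insert.prems(1) pb mult.assoc)
    then show ?thesis
      by (simp add: a'_def left_diff_distrib right_diff_distrib distrib_left distrib_right
          scaleC_simps insert.prems(1) pb)
  qed
  have sub: "alg_spectrum a' \<inter> alg_spectrum b \<subseteq> K"
  proof
    fix l assume l: "l \<in> alg_spectrum a' \<inter> alg_spectrum b"
    with cb have lc: "l \<noteq> c" by auto
    then have uc: "unit_elem ((c - l) *\<^sub>C (1::'a))" by (intro unit_elem_scaleC) auto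
    have not_u: "\<not> unit_elem (a' - l *\<^sub>C 1)" using l by (simp add: alg_spectrum_def)
    have "l \<in> alg_spectrum a"
    proof (rule ccontr)
      assume "l \<notin> alg_spectrum a"
      then have "unit_elem (a - l *\<^sub>C 1)" by (simp add: alg_spectrum_def)
      from corner_unit_elem[OF p(1) uc this a'p commute_scaleC_one a'q pl[OF ap]] not_u
      show False by simp
    qed
    then have "l \<in> insert g K" using l insert.prems(2) by auto
    moreover have "l \<noteq> g"
    proof
      assume lg: "l = g"
      \<comment> \<open>On the corner of \<open>1 - p\<close>, \<open>a - g\<close> agrees with this
        unit, so \<open>g\<close> has left the spectrum.\<close>
      have u: "unit_elem (t * (1 - p) + p)" unfolding p_def by (rule drazin_unit_part[OF dr])
      have q: "(a' - l *\<^sub>C 1) * (1 - p) = (t * (1 - p) + p) * (1 - p)"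
        unfolding a'q lg
        by (simp add: t_def left_diff_distrib right_diff_distrib distrib_left distrib_right
            scaleC_simps mult.assoc p(1))
      have "p * (t * (1 - p) + p) = (t * (1 - p) + p) * p"
        by (simp add: left_diff_distrib right_diff_distrib distrib_left distrib_right tp)
          (metis tp p(1) mult.assoc)
      from corner_unit_elem[OF p(1) uc u a'p commute_scaleC_one q this] not_u
      show False by simp
    qed
    ultimately show "l \<in> K" by auto
  qed
  have dra': "drazin (a' - l *\<^sub>C 1)" if "l \<in> K" for l
  proof (rule corner_drazin[OF p(1) _ _ a'p commute_scaleC_one a'q pl[OF ap]])
    have "l \<noteq> c" using that c by auto
    then show "drazin ((c - l) *\<^sub>C (1::'a))" by (intro unit_elem_drazin unit_elem_scaleC) auto
    show "drazin (a - l *\<^sub>C 1)" using that insert.prems(3) by auto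
  qed
  have dr2: "drazin (b - a')"
    by (rule insert.IH[OF comm sub dra' insert.prems(4)]) auto
  have nil: "(- (t * p)) ^ Suc k = 0"
    unfolding p_def by (rule minus_power_eq_0[OF drazin_nilpotent_part[OF dr]])
  obtain s' k' where dr': "drazin_inverse (b - g *\<^sub>C 1) s' k'"
    using insert.prems(4)[of g] by (auto simp: drazin_def)
  have tpb: "(t * p) * b = b * (t * p)" by (metis bt pb mult.assoc)
  have "drazin (b - g *\<^sub>C 1 + - (t * p))"
    by (rule drazin_add_nilpotent[OF dr' _ nil])
      (simp add: left_diff_distrib right_diff_distrib scaleC_simps tpb)
  then show ?case
  proof (rule corner_drazin[OF p(1) _ dr2])
    show "(b - a) * p = (b - g *\<^sub>C 1 + - (t * p)) * p"
      by (simp add: a_t left_diff_distrib distrib_right mult.assoc p(1))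
    have "p * (t * p) = (t * p) * p" by (simp add: idempotent_absorb[OF p(1) tp] mult.assoc p(1))
    then show "p * (b - g *\<^sub>C 1 + - (t * p)) = (b - g *\<^sub>C 1 + - (t * p)) * p"
      by (simp add: left_diff_distrib right_diff_distrib scaleC_simps pb)
    show "(b - a) * (1 - p) = (b - a') * (1 - p)"
      using a'q[of 0] by (simp add: left_diff_distrib)
    have "p * a' = a' * p"
      by (simp add: a'_def left_diff_distrib right_diff_distrib distrib_left distrib_right
          scaleC_simps ap)
        (simp add: idempotent_absorb[OF p(1) ap[symmetric]] mult.assoc p(1))
    then show "p * (b - a') = (b - a') * p"
      by (simp add: left_diff_distrib right_diff_distrib pb)
  qed
qed

section \<open>The Banach algebra of operators\<close>

text \<open>A type copy, because composition is a multiplication only when source and target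
  coincide, whereas a class instance for \<open>cblinfun\<close> has to treat two independent type
  arguments.\<close>

typedef (overloaded) 'a endo = "UNIV :: ('a::cbanach \<Rightarrow>\<^sub>C\<^sub>L 'a) set"
  morphisms endo_op Endo
  by simp

setup_lifting type_definition_endo

lemma endo_eqI: "(\<And>x. cblinfun_apply (endo_op s) x = cblinfun_apply (endo_op t) x) \<Longrightarrow> s = t"
  by (metis cblinfun_eqI endo_op_inject)

instantiation endo :: (cbanach) complex_normed_vector
begin

lift_definition norm_endo :: "'a endo \<Rightarrow> real" is norm .
lift_definition zero_endo :: "'a endo" is 0 .
lift_definition plus_endo :: "'a endo \<Rightarrow> 'a endo \<Rightarrow> 'a endo" is "(+)" .
lift_definition minus_endo :: "'a endo \<Rightarrow> 'a endo \<Rightarrow> 'a endo" is "(-)" .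
lift_definition uminus_endo :: "'a endo \<Rightarrow> 'a endo" is uminus .
lift_definition scaleR_endo :: "real \<Rightarrow> 'a endo \<Rightarrow> 'a endo" is "(*\<^sub>R)" .
lift_definition scaleC_endo :: "complex \<Rightarrow> 'a endo \<Rightarrow> 'a endo" is "(*\<^sub>C)" .

definition dist_endo :: "'a endo \<Rightarrow> 'a endo \<Rightarrow> real"
  where "dist_endo f g = norm (f - g)"

definition uniformity_endo :: "('a endo \<times> 'a endo) filter"
  where "uniformity_endo = (INF e\<in>{0 <..}. principal {(x, y). dist x y < e})"

definition open_endo :: "'a endo set \<Rightarrow> bool"
  where "open_endo S = (\<forall>x\<in>S. \<forall>\<^sub>F (x', y) in uniformity. x' = x \<longrightarrow> y \<in> S)"

definition sgn_endo :: "'a endo \<Rightarrow> 'a endo"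
  where "sgn_endo f = inverse (norm f) *\<^sub>R f"

instance
proof
  fix f g h :: "'a endo" and a b :: complex and r s :: real
  show "f + g + h = f + (g + h)" by transfer (rule add.assoc)
  show "f + g = g + f" by transfer (rule add.commute)
  show "0 + f = f" by transfer simp
  show "- f + f = 0" by transfer simp
  show "f - g = f + - g" by transfer simp
  show "r *\<^sub>R (f + g) = r *\<^sub>R f + r *\<^sub>R g" by transfer (rule scaleR_add_right)
  show "(r + s) *\<^sub>R f = r *\<^sub>R f + s *\<^sub>R f" by transfer (rule scaleR_add_left)
  show "r *\<^sub>R s *\<^sub>R f = (r * s) *\<^sub>R f" by transfer simp
  show "1 *\<^sub>R f = f" by transfer simp
  show "a *\<^sub>C (f + g) = a *\<^sub>C f + a *\<^sub>C g" by transfer (rule scaleC_add_right)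
  show "(a + b) *\<^sub>C f = a *\<^sub>C f + b *\<^sub>C f" by transfer (rule scaleC_add_left)
  show "a *\<^sub>C b *\<^sub>C f = (a * b) *\<^sub>C f" by transfer (rule scaleC_scaleC)
  show "complex_of_real r *\<^sub>C f = r *\<^sub>R f" by transfer (rule scaleC_of_real)
  show "dist f g = norm (f - g)" by (fact dist_endo_def)
  show "sgn f = inverse (norm f) *\<^sub>R f" by (fact sgn_endo_def)
  show "uniformity = (INF e\<in>{0 <..}. principal {(x :: 'a endo, y). dist x y < e})"
    by (fact uniformity_endo_def)
  show "open S \<longleftrightarrow> (\<forall>x\<in>S. \<forall>\<^sub>F (x', y) in uniformity. x' = x \<longrightarrow> y \<in> S)" for S :: "'a endo set"
    by (fact open_endo_def)
  show "norm f = 0 \<longleftrightarrow> f = 0" by transfer simp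
  show "norm (f + g) \<le> norm f + norm g" by transfer (rule norm_triangle_ineq)
  show "norm (r *\<^sub>R f) = \<bar>r\<bar> * norm f" by transfer simp
  show "norm (a *\<^sub>C f) = cmod a * norm f" by transfer (rule norm_scaleC)
qed

end

instance endo :: (cbanach) cbanach
proof
  fix X :: "nat \<Rightarrow> 'a endo"
  have dist: "dist (endo_op x) (endo_op y) = dist x y" for x y :: "'a endo"
    unfolding dist_norm by transfer simp
  assume "Cauchy X"
  then have "Cauchy (\<lambda>n. endo_op (X n))"
    by (simp add: Cauchy_def dist)
  then obtain L where "(\<lambda>n. endo_op (X n)) \<longlonglongrightarrow> L"
    using Cauchy_convergent_iff convergent_def by blast
  then have "X \<longlonglongrightarrow> Endo L"
    by (simp add: tendsto_dist_iff[of _ L] tendsto_dist_iff[of _ "Endo L"] Endo_inverse flip: dist)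
  then show "convergent X"
    by (rule convergentI)
qed

instantiation endo :: (cbanach) cbanach_algebra
begin

lift_definition one_endo :: "'a endo" is id_cblinfun .
lift_definition times_endo :: "'a endo \<Rightarrow> 'a endo \<Rightarrow> 'a endo" is "(o\<^sub>C\<^sub>L)" .

instance
proof
  fix f g h :: "'a endo" and a :: complex and r :: real
  show "f * g * h = f * (g * h)"
    by (rule endo_eqI, transfer) (simp add: cblinfun_left_simps)
  show "(f + g) * h = f * h + g * h" "f * (g + h) = f * g + f * h"
    by (rule endo_eqI, transfer, simp add: cblinfun_left_simps cblinfun_right_simps)+
  show "1 * f = f" "f * 1 = f"
    by (rule endo_eqI, transfer, simp add: cblinfun_left_simps)+
  show "r *\<^sub>R f * g = r *\<^sub>R (f * g)" "f * r *\<^sub>R g = r *\<^sub>R (f * g)"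
    by (rule endo_eqI, transfer, simp add: cblinfun_left_simps cblinfun_right_simps)+
  show "a *\<^sub>C f * g = a *\<^sub>C (f * g)" "f * a *\<^sub>C g = a *\<^sub>C (f * g)"
    by (rule endo_eqI, transfer, simp add: cblinfun_left_simps cblinfun_right_simps)+
  show "norm (f * g) \<le> norm f * norm g" by transfer (rule norm_cblinfun_compose)
qed

end

lemmas endo_op_simps = plus_endo.rep_eq minus_endo.rep_eq uminus_endo.rep_eq zero_endo.rep_eq
  one_endo.rep_eq times_endo.rep_eq scaleC_endo.rep_eq cblinfun_left_simps

lemma endo_op_Endo [simp]: "endo_op (Endo T) = T"
  by (simp add: Endo_inverse)

lemma Endo_minus_scalar: "Endo (T - l *\<^sub>C id_cblinfun) = Endo T - l *\<^sub>C 1"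
  by (rule endo_eqI) (simp add: endo_op_simps)

lemma endo_op_power: "endo_op (t ^ n) = cblinfun_power (endo_op t) n"
  by (induction n) (simp_all add: times_endo.rep_eq one_endo.rep_eq)

lemma unit_elem_Endo_iff:
  "unit_elem (Endo T) \<longleftrightarrow> (\<exists>S. S o\<^sub>C\<^sub>L T = id_cblinfun \<and> T o\<^sub>C\<^sub>L S = id_cblinfun)"
proof
  assume "unit_elem (Endo T)"
  then obtain s where s: "s * Endo T = 1" "Endo T * s = 1" by (auto simp: unit_elem_def)
  show "\<exists>S. S o\<^sub>C\<^sub>L T = id_cblinfun \<and> T o\<^sub>C\<^sub>L S = id_cblinfun"
    using arg_cong[OF s(1), of endo_op] arg_cong[OF s(2), of endo_op]
    by (auto simp: times_endo.rep_eq one_endo.rep_eq)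
next
  assume "\<exists>S. S o\<^sub>C\<^sub>L T = id_cblinfun \<and> T o\<^sub>C\<^sub>L S = id_cblinfun"
  then obtain S where S: "S o\<^sub>C\<^sub>L T = id_cblinfun" "T o\<^sub>C\<^sub>L S = id_cblinfun" by blast
  show "unit_elem (Endo T)"
    by (rule unit_elemI[of "Endo S"]; subst endo_op_inject[symmetric])
      (simp_all add: times_endo.rep_eq one_endo.rep_eq S)
qed

lemma spectrum_eq_alg_spectrum: "spectrum T = alg_spectrum (Endo T)"
  by (simp add: spectrum_def alg_spectrum_def unit_elem_Endo_iff flip: Endo_minus_scalar)

section \<open>The open mapping theorem\<close>

text \<open>Successive approximation: each correction halves the remaining error \<open>r n\<close>,
  and summing the corrections turns \<open>c\<close> into \<open>2 * c\<close>. Closedness keeps the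
  sum in \<open>V\<close>.\<close>

lemma approximately_onto_imp_onto:
  fixes T :: "'a::banach \<Rightarrow> 'b::real_normed_vector"
  assumes T: "bounded_linear T" and V: "closed V" "subspace V" and c: "0 \<le> c"
    and approx: "\<And>y e. 0 < e \<Longrightarrow> \<exists>v\<in>V. norm v \<le> c * norm y \<and> norm (y - T v) < e"
  shows "\<exists>v\<in>V. T v = y \<and> norm v \<le> 2 * c * norm y"
proof -
  interpret T: bounded_linear T by (rule T)
  have "\<exists>v\<in>V. norm v \<le> c * norm y \<and> norm (y - T v) \<le> norm y / 2" for y
  proof (cases "y = 0")
    case True
    then show ?thesis using subspace_0[OF V(2)] by (intro bexI[of _ 0]) (auto simp: T.zero)
  next
    case False
    then show ?thesis using approx[of "norm y / 2" y] by fastforce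
  qed
  then obtain g where g: "\<And>y. g y \<in> V" "\<And>y. norm (g y) \<le> c * norm y"
    "\<And>y. norm (y - T (g y)) \<le> norm y / 2"
    by metis
  define r where "r n = ((\<lambda>z. z - T (g z)) ^^ n) y" for n
  have r_le: "norm (r n) \<le> norm y * (1 / 2) ^ n" for n
  proof (induction n)
    case (Suc n)
    have "norm (r (Suc n)) \<le> norm (r n) / 2" using g(3)[of "r n"] by (simp add: r_def)
    with Suc show ?case by simp
  qed (simp add: r_def)
  have g_le: "norm (g (r n)) \<le> (c * norm y) * (1 / 2) ^ n" for n
    using order_trans[OF g(2) mult_left_mono[OF r_le c]] by (simp add: mult.assoc)
  have geo: "(\<lambda>n. (c * norm y) * (1 / 2) ^ n) sums (2 * c * norm y)"
    using sums_mult[OF geometric_sums[of "1 / 2 :: real"], of "c * norm y"] by (simp add: mult_ac)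
  have summ: "summable (\<lambda>n. norm (g (r n)))"
    by (rule summable_comparison_test'[OF sums_summable[OF geo], of 0]) (use g_le in auto)
  define v where "v = (\<Sum>n. g (r n))"
  have lim: "(\<lambda>n. \<Sum>i<n. g (r i)) \<longlonglongrightarrow> v"
    unfolding v_def using summable_LIMSEQ[OF summable_norm_cancel[OF summ]] .
  have "v \<in> V"
    by (rule closed_sequentially[OF V(1) _ lim]) (simp add: subspace_sum[OF V(2)] g(1))
  moreover have "T v = y"
  proof -
    have partial: "T (\<Sum>i<n. g (r i)) = y - r n" for n
      by (induction n) (simp_all add: r_def T.zero T.add)
    have "r \<longlonglongrightarrow> 0"
    proof (rule Lim_null_comparison)
      show "eventually (\<lambda>n. norm (r n) \<le> norm y * (1 / 2) ^ n) sequentially" using r_le by simp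
      have "(\<lambda>n. norm y * (1 / 2) ^ n) \<longlonglongrightarrow> norm y * 0"
        by (intro tendsto_intros LIMSEQ_power_zero) simp
      then show "(\<lambda>n. norm y * (1 / 2) ^ n) \<longlonglongrightarrow> 0" by simp
    qed
    then have "(\<lambda>n. y - r n) \<longlonglongrightarrow> y - 0" by (intro tendsto_intros)
    with T.tendsto[OF lim] show ?thesis unfolding partial using LIMSEQ_unique by fastforce
  qed
  moreover have "norm v \<le> 2 * c * norm y"
    unfolding v_def using suminf_le[OF g_le summ sums_summable[OF geo]] sums_unique[OF geo]
      summable_norm[OF summ] by simp
  ultimately show ?thesis by blast
qed

text \<open>Baire's theorem yields a ball in the closure of the image of some ball of
  \<open>V\<close>. The domain is a closed subspace given as a set, since the application below is
  to the kernel of an operator times the whole space.\<close>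

lemma open_mapping:
  fixes T :: "'a::banach \<Rightarrow> 'b::banach"
  assumes T: "bounded_linear T" and V: "closed V" "subspace V" and onto: "T ` V = UNIV"
  obtains C where "0 \<le> C" "\<And>y. \<exists>v\<in>V. T v = y \<and> norm v \<le> C * norm y"
proof -
  interpret T: bounded_linear T by (rule T)
  define F where "F n = closure (T ` (V \<inter> cball 0 (real n)))" for n
  have "\<exists>n. interior (F n) \<noteq> {}"
  proof (rule ccontr)
    assume "\<not> ?thesis"
    then have "Met_TC.mtopology interior_of (\<Union>(range F)) = ({} :: 'b set)"
      by (intro Met_TC.metric_Baire_category_alt) (auto simp: F_def Met_TC.mcomplete_def
          Cauchy_convergent_iff convergent_def)
    moreover have "y \<in> \<Union>(range F)" for y
    proof -
      obtain v where v: "v \<in> V" "T v = y" using onto by (metis UNIV_I imageE)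
      obtain n where "norm v \<le> real n" using real_arch_simple by blast
      with v have "y \<in> F n" unfolding F_def by (intro closure_subset[THEN subsetD]) auto
      then show ?thesis by blast
    qed
    then have "\<Union>(range F) = UNIV" by blast
    ultimately show False by simp
  qed
  then obtain n y0 where "y0 \<in> interior (F n)" by blast
  then obtain r where r: "0 < r" "ball y0 r \<subseteq> F n" by (auto simp: mem_interior)
  \<comment> \<open>With \<open>a = r / (2 * norm y)\<close> the point
    \<open>y0 + a *\<^sub>R y\<close> stays in the ball. Approximating it and \<open>y0\<close> by
    images of \<open>v1\<close> and \<open>v2\<close> costs at most \<open>2 * real n\<close> for
    \<open>v1 - v2\<close>, and dividing by \<open>a\<close> gives
    \<open>c * norm y\<close>.\<close>
  define c where "c = 4 * real n / r"
  have approx: "\<exists>v\<in>V. norm v \<le> c * norm y \<and> norm (y - T v) < e" if "0 < e" for y e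
  proof (cases "y = 0")
    case True
    then show ?thesis
      using subspace_0[OF V(2)] that by (intro bexI[of _ 0]) (auto simp: T.zero)
  next
    case False
    define a where "a = r / (2 * norm y)"
    have a: "0 < a" using r(1) False by (simp add: a_def)
    have mem: "\<exists>v\<in>V. norm v \<le> real n \<and> dist (T v) z < a * e / 2" if "z \<in> F n" for z
      using that a \<open>0 < e\<close> unfolding F_def closure_approachable
      by (auto dest!: spec[of _ "a * e / 2"])
    have "dist y0 (y0 + a *\<^sub>R y) < r"
      using r(1) False by (simp add: dist_norm a_def)
    then have "y0 + a *\<^sub>R y \<in> F n" "y0 \<in> F n" using r by (auto simp: subset_eq)
    then obtain v1 v2 where v1: "v1 \<in> V" "norm v1 \<le> real n" "dist (T v1) (y0 + a *\<^sub>R y) < a * e / 2"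
      and v2: "v2 \<in> V" "norm v2 \<le> real n" "dist (T v2) y0 < a * e / 2"
      using mem by meson
    define v where "v = (1 / a) *\<^sub>R (v1 - v2)"
    have "v \<in> V" unfolding v_def using v1 v2 V(2) by (intro subspace_scale subspace_diff)
    moreover have "norm v \<le> c * norm y"
    proof -
      have "norm v = norm (v1 - v2) / a" using a by (simp add: v_def)
      also have "\<dots> \<le> 2 * real n / a"
        using norm_triangle_ineq4[of v1 v2] v1 v2 a by (intro divide_right_mono) auto
      finally show ?thesis using r(1) by (simp add: a_def c_def field_simps)
    qed
    moreover have "norm (y - T v) < e"
    proof -
      have "a * norm (y - T v) = norm (a *\<^sub>R (y - T v))" using a by simp
      also have "a *\<^sub>R (y - T v) = (y0 + a *\<^sub>R y - T v1) - (y0 - T v2)"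
        using a by (simp add: v_def T.scaleR T.diff scaleR_diff_right)
      also have "norm \<dots> < a * e"
        using norm_triangle_ineq4[of "y0 + a *\<^sub>R y - T v1" "y0 - T v2"] v1(3) v2(3)
        by (simp add: dist_norm norm_minus_commute)
      finally show ?thesis using a by simp
    qed
    ultimately show ?thesis by blast
  qed
  show thesis
  proof (rule that)
    show "0 \<le> 2 * c" using r(1) by (simp add: c_def)
    then show "\<exists>v\<in>V. T v = y \<and> norm v \<le> 2 * c * norm y" for y
      by (intro approximately_onto_imp_onto[OF T V] approx) auto
  qed
qed

section \<open>Poles and Drazin invertibility\<close>

text \<open>The hypotheses say that ascent and descent are at most 1, so the space is the direct sum
  of kernel and range; \<open>D\<close> kills the kernel and inverts \<open>f\<close> on the range.
  For boundedness, the open mapping theorem is applied to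
  \<open>(n, w) \<mapsto> n + f (f w)\<close> with \<open>n\<close> in the kernel: it controls
  \<open>norm w\<close>, and \<open>D x = f w\<close>.\<close>

lemma drazin_of_index_one:
  fixes S :: "'a::cbanach \<Rightarrow>\<^sub>C\<^sub>L 'a"
  defines "f \<equiv> cblinfun_apply S"
  assumes inj: "\<And>x. f (f x) = 0 \<Longrightarrow> f x = 0" and onto: "\<And>x. \<exists>w. f x = f (f w)"
  shows "drazin (Endo S)"
proof -
  note lin = cblinfun_right_simps[of S, folded f_def]
  have blf: "bounded_linear f" unfolding f_def by (rule bounded_linear_cblinfun_apply)
  define V where "V = {z :: 'a \<times> 'a. f (fst z) = 0}"
  define T where "T z = fst z + f (f (snd z))" for z
  have T: "bounded_linear T"
    unfolding T_def
    by (intro bounded_linear_add bounded_linear_fst bounded_linear_compose[OF blf] bounded_linear_snd)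
  have "closed V"
    unfolding V_def
    by (intro closed_Collect_eq continuous_on_const
        bounded_linear.continuous_on[OF bounded_linear_compose[OF blf bounded_linear_fst]]
        continuous_on_id)
  moreover have "subspace V" by (auto simp: subspace_def V_def lin)
  moreover have "T ` V = UNIV"
  proof (intro equalityI subsetI)
    fix x
    obtain w where w: "f x = f (f w)" using onto by blast
    obtain w' where w': "f w = f (f w')" using onto by blast
    have "(x - f w, w') \<in> V" "x = T (x - f w, w')" by (auto simp: V_def T_def lin w w')
    then show "x \<in> T ` V" by blast
  qed simp
  ultimately obtain C where C: "0 \<le> C" "\<And>y. \<exists>v\<in>V. T v = y \<and> norm v \<le> C * norm y"
    using open_mapping[OF T] by metis
  \<comment> \<open>A decomposition \<open>x = n + f (f w)\<close> does not determine
    \<open>w\<close>, but it determines \<open>f w\<close>.\<close>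
  define D where "D x = (THE d. \<exists>n w. f n = 0 \<and> x = n + f (f w) \<and> d = f w)" for x
  have D: "D x = f w" if "f n = 0" "x = n + f (f w)" for x n w
    unfolding D_def
  proof (rule the_equality)
    fix d assume "\<exists>n w. f n = 0 \<and> x = n + f (f w) \<and> d = f w"
    then obtain n' w' where nw: "f n' = 0" "x = n' + f (f w')" "d = f w'" by blast
    have "f (n' + f (f w')) = f (n + f (f w))" using nw(2) that(2) by simp
    then have "f (f (f (w' - w))) = 0" by (simp add: lin nw(1) that(1))
    then have "f (w' - w) = 0" using inj by blast
    then show "d = f w" by (simp add: lin nw)
  qed (use that in blast)
  have dec: "\<exists>n w. f n = 0 \<and> x = n + f (f w) \<and> norm w \<le> C * norm x" for x
  proof -
    obtain n w where "(n, w) \<in> V" "T (n, w) = x" "norm (n, w) \<le> C * norm x"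
      using C(2)[of x] by (metis surj_pair)
    then show ?thesis
      using order_trans[OF norm_snd_le[of w n]] by (intro exI[of _ n] exI[of _ w]) (auto simp: V_def T_def)
  qed
  have app: "cblinfun_apply (CBlinfun D) = D"
  proof (rule cblinfun_apply_CBlinfun)
    fix x y c
    obtain n w where x: "f n = 0" "x = n + f (f w)" "norm w \<le> C * norm x" using dec by blast
    obtain n' w' where y: "f n' = 0" "y = n' + f (f w')" using dec by blast
    show "D (x + y) = D x + D y"
      using D[of "n + n'" "x + y" "w + w'"] D[OF x(1,2)] D[OF y] by (simp add: lin x y)
    show "D (c *\<^sub>C x) = c *\<^sub>C D x"
      using D[of "c *\<^sub>C n" "c *\<^sub>C x" "c *\<^sub>C w"] D[OF x(1,2)]
      by (simp add: lin x(1,2) scaleC_add_right)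
    have "norm (D x) \<le> norm S * norm w" unfolding D[OF x(1,2)] f_def by (rule norm_cblinfun)
    also have "\<dots> \<le> norm S * (C * norm x)" by (intro mult_left_mono x) simp
    finally show "norm (D x) \<le> (norm S * C) * norm x" by (simp add: mult.assoc)
  qed
  have fx: "f x = f (f (D x))" "D (f x) = f (D x)" "D (f (D x)) = D x" for x
  proof -
    obtain n w where x: "f n = 0" "x = n + f (f w)" using dec by blast
    show 1: "f x = f (f (D x))" unfolding D[OF x] using x by (simp add: lin)
    show "D (f x) = f (D x)" using D[of 0 "f x" "D x"] 1 by (simp add: lin)
    show "D (f (D x)) = D x" using D[of 0 "f (f w)" w] D[OF x] by (simp add: lin)
  qed
  have "drazin_inverse (Endo S) (Endo (CBlinfun D)) 1"
    unfolding drazin_inverse_def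
  proof (intro conjI; rule endo_eqI)
    fix x
    show "cblinfun_apply (endo_op (Endo S * Endo (CBlinfun D))) x
        = cblinfun_apply (endo_op (Endo (CBlinfun D) * Endo S)) x"
      by (simp add: endo_op_simps app fx(2) flip: f_def)
    show "cblinfun_apply (endo_op (Endo (CBlinfun D) * Endo S * Endo (CBlinfun D))) x
        = cblinfun_apply (endo_op (Endo (CBlinfun D))) x"
      by (simp add: endo_op_simps app fx(3) flip: f_def)
    show "cblinfun_apply (endo_op (Endo S ^ Suc 1 * Endo (CBlinfun D))) x
        = cblinfun_apply (endo_op (Endo S ^ 1)) x"
      by (simp add: endo_op_simps app flip: f_def fx(1))
  qed
  then show ?thesis by (rule drazinI)
qed

text \<open>The candidate \<open>t ^ m * D\<close> satisfies
  \<open>t * (t ^ m * D) = t ^ Suc m * D\<close>, so the equations for the power carry over. This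
  reduces finite index to index one.\<close>

lemma drazin_of_power:
  assumes "drazin (t ^ Suc m)"
  shows "drazin t"
proof -
  obtain D j where D: "drazin_inverse (t ^ Suc m) D j" using assms by (auto simp: drazin_def)
  have tD: "t * D = D * t"
    by (rule drazin_inverse_commute[OF D]) (simp add: power_commutes mult.assoc)
  have d: "D * t ^ Suc m * D = D" "(t ^ Suc m) ^ Suc j * D = (t ^ Suc m) ^ j"
    using D by (simp_all add: drazin_inverse_def)
  have tmD: "D * t ^ m = t ^ m * D" by (rule commute_power) (simp add: tD)
  have ts: "t * (t ^ m * D) = t ^ Suc m * D" by (simp add: mult.assoc)
  have st: "(t ^ m * D) * t = t ^ Suc m * D"
    by (simp add: mult.assoc power_commutes flip: tD) (simp add: power_commutes flip: mult.assoc)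
  have "drazin_inverse t (t ^ m * D) (Suc m * j)"
    unfolding drazin_inverse_def
  proof (intro conjI)
    show "t * (t ^ m * D) = t ^ m * D * t" using ts st by simp
    have "t ^ m * D * t * (t ^ m * D) = t ^ m * (D * t ^ Suc m * D)" by (simp add: mult.assoc)
    then show "t ^ m * D * t * (t ^ m * D) = t ^ m * D" by (simp only: d)
    have "t ^ Suc (Suc m * j) * (t ^ m * D) = t ^ (Suc m * j) * (t * (t ^ m * D))"
      by (simp only: power_Suc2 mult.assoc)
    also have "\<dots> = (t ^ Suc m) ^ Suc j * D"
      by (simp only: ts power_Suc2[of "t ^ Suc m"] power_mult mult.assoc)
    finally show "t ^ Suc (Suc m * j) * (t ^ m * D) = t ^ (Suc m * j)"
      by (simp only: d power_mult)
  qed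
  then show ?thesis by (rule drazinI)
qed

lemma null_space_power_iff:
  "null_space (cblinfun_power T n) = null_space (cblinfun_power T (Suc n)) \<longleftrightarrow>
    (\<forall>x. cblinfun_apply (endo_op (Endo T ^ Suc n)) x = 0 \<longrightarrow> cblinfun_apply (endo_op (Endo T ^ n)) x = 0)"
proof -
  have "null_space (cblinfun_power T n) \<subseteq> null_space (cblinfun_power T (Suc n))"
    by (auto simp: null_space_def cblinfun_compose.rep_eq cblinfun_right_simps)
  then have "null_space (cblinfun_power T n) = null_space (cblinfun_power T (Suc n)) \<longleftrightarrow>
      null_space (cblinfun_power T (Suc n)) \<subseteq> null_space (cblinfun_power T n)"
    by blast
  then show ?thesis
    by (simp only: null_space_def Collect_mono_iff endo_op_power endo_op_Endo)
qed

lemma range_space_power_iff: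
  "range_space (cblinfun_power T n) = range_space (cblinfun_power T (Suc n)) \<longleftrightarrow>
    (\<forall>x. \<exists>y. cblinfun_apply (endo_op (Endo T ^ n)) x = cblinfun_apply (endo_op (Endo T ^ Suc n)) y)"
proof -
  have "cblinfun_power T (Suc n) = endo_op (Endo T ^ n * Endo T)"
    using endo_op_power[of "Endo T" "Suc n"] by (simp add: power_commutes)
  then have "range_space (cblinfun_power T (Suc n)) \<subseteq> range_space (cblinfun_power T n)"
    by (auto simp: range_space_def times_endo.rep_eq cblinfun_compose.rep_eq endo_op_power)
  then have "range_space (cblinfun_power T n) = range_space (cblinfun_power T (Suc n)) \<longleftrightarrow>
      range_space (cblinfun_power T n) \<subseteq> range_space (cblinfun_power T (Suc n))"
    by blast
  also have "\<dots> \<longleftrightarrow> (\<forall>x. \<exists>y. cblinfun_apply (cblinfun_power T n) x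
      = cblinfun_apply (cblinfun_power T (Suc n)) y)"
    unfolding range_space_def image_subset_iff by (simp only: image_iff UNIV_I ball_UNIV bex_UNIV)
  finally show ?thesis by (simp only: endo_op_power endo_op_Endo)
qed

lemma finite_ascent_descent_imp_drazin:
  assumes "ascent T < \<infinity>" "descent T < \<infinity>"
  shows "drazin (Endo T)"
proof -
  define F where "F n = cblinfun_apply (endo_op (Endo T ^ n))" for n
  have F_add: "F (m + n) x = F m (F n x)" for m n x
    by (simp add: F_def power_add times_endo.rep_eq cblinfun_compose.rep_eq)
  have F0: "F n 0 = 0" for n by (simp add: F_def cblinfun_right_simps)
  have "{n. null_space (cblinfun_power T n) = null_space (cblinfun_power T (Suc n))} \<noteq> {}"
    (is "?S \<noteq> {}")
  proof
    assume "?S = {}"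
    then have "ascent T = \<infinity>" unfolding ascent_def by (simp only: image_empty Inf_empty top_enat_def)
    with assms(1) show False by simp
  qed
  then obtain a where a: "\<And>x. F (Suc a) x = 0 \<Longrightarrow> F a x = 0"
    unfolding null_space_power_iff F_def by blast
  have "{n. range_space (cblinfun_power T n) = range_space (cblinfun_power T (Suc n))} \<noteq> {}"
    (is "?S \<noteq> {}")
  proof
    assume "?S = {}"
    then have "descent T = \<infinity>" unfolding descent_def by (simp only: image_empty Inf_empty top_enat_def)
    with assms(2) show False by simp
  qed
  then obtain d where d: "\<And>x. \<exists>y. F d x = F (Suc d) y"
    unfolding range_space_power_iff F_def by blast
  have null: "F (a + j) x = 0 \<Longrightarrow> F a x = 0" for j x
  proof (induction j)
    case (Suc j)
    have "F (Suc a) (F j x) = 0" using Suc.prems F_add[of "Suc a" j x] by simp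
    then have "F (a + j) x = 0" using a F_add[of a j x] by simp
    then show ?case by (rule Suc.IH)
  qed simp
  have range: "\<exists>y. F d x = F (d + j) y" for j x
  proof (induction j)
    case (Suc j)
    then obtain y where y: "F d x = F (d + j) y" by blast
    obtain z where "F d y = F (Suc d) z" using d by blast
    then have "F (j + d) y = F (j + Suc d) z" by (simp only: F_add)
    with y show ?case by (auto simp: add.commute)
  qed auto
  \<comment> \<open>From index \<open>a\<close> on the kernels are constant and from
    \<open>d\<close> on the ranges are. Hence the power with exponent \<open>Suc m\<close> has
    ascent and descent at most 1, and being a successor the exponent fits
    \<open>drazin_of_power\<close>.\<close>
  define m where "m = a + d"
  have inj: "F (Suc m) x = 0" if "F (Suc m) (F (Suc m) x) = 0" for x
  proof -
    have "F (Suc m + Suc m) x = 0" using that by (simp only: F_add)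
    then have "F a x = 0" using null[of "Suc m + Suc d" x] by (simp add: m_def add_ac)
    then have "F (Suc d + a) x = 0" by (simp only: F_add F0)
    then show ?thesis by (simp add: m_def add_ac)
  qed
  have onto: "\<exists>w. F (Suc m) x = F (Suc m) (F (Suc m) w)" for x
  proof -
    obtain y where "F d x = F (d + Suc m) y" using range by blast
    then have "F (Suc a + d) x = F (Suc a + (d + Suc m)) y" by (simp only: F_add)
    then have "F (Suc m) x = F (Suc m + Suc m) y" by (simp add: m_def add_ac)
    then show ?thesis by (auto simp only: F_add)
  qed
  have "drazin (Endo (endo_op (Endo T ^ Suc m)))"
    by (rule drazin_of_index_one; fold F_def) (rule inj onto; assumption?)+
  then have "drazin (Endo T ^ Suc m)" by (simp only: endo_op_inverse)
  then show ?thesis by (rule drazin_of_power)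
qed

text \<open>Stabilization of the kernels at \<open>n\<close> and of the ranges at \<open>n\<close>
  are both equivalent to \<open>t ^ n * p = 0\<close>. The two index sets therefore coincide, and
  \<open>k\<close> belongs to them.\<close>

lemma drazin_imp_finite_ascent_descent:
  assumes "drazin (Endo T)"
  shows "ascent T = descent T" "descent T < \<infinity>"
proof -
  define t where "t = Endo T"
  obtain s k where dr: "drazin_inverse t s k" using assms by (auto simp: drazin_def t_def)
  define p where "p = 1 - t * s"
  note p = drazin_projection[OF dr, folded p_def]
  define F where "F n = cblinfun_apply (endo_op (t ^ n))" for n
  have F_add: "F (m + n) x = F m (F n x)" for m n x
    by (simp add: F_def power_add times_endo.rep_eq cblinfun_compose.rep_eq)
  have mult: "cblinfun_apply (endo_op (x * y)) v = cblinfun_apply (endo_op x) (cblinfun_apply (endo_op y) v)"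
    for x y :: "'a endo" and v by (simp add: times_endo.rep_eq cblinfun_compose.rep_eq)
  have pc: "p * t ^ n = t ^ n * p" for n by (rule commute_power) (simp add: p(2))
  define AS where "AS = {n. null_space (cblinfun_power T n) = null_space (cblinfun_power T (Suc n))}"
  define DS where "DS = {n. range_space (cblinfun_power T n) = range_space (cblinfun_power T (Suc n))}"
  have AS: "n \<in> AS \<longleftrightarrow> (\<forall>x. F (Suc n) x = 0 \<longrightarrow> F n x = 0)" for n
    unfolding AS_def mem_Collect_eq null_space_power_iff F_def t_def ..
  have DS: "n \<in> DS \<longleftrightarrow> (\<forall>x. \<exists>y. F n x = F (Suc n) y)" for n
    unfolding DS_def mem_Collect_eq range_space_power_iff F_def t_def ..
  have eq: "t ^ n = t ^ Suc n * s" "t ^ n = s * t ^ Suc n" if tp: "t ^ n * p = 0" for n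
  proof -
    have "t ^ n = t ^ n * (1 - p)" using tp by (simp add: right_diff_distrib)
    also have "\<dots> = t ^ n * t * s" by (simp only: p(6)[symmetric] mult.assoc)
    finally show "t ^ n = t ^ Suc n * s" by (simp only: power_Suc2)
    have "t ^ n = (1 - p) * t ^ n" using tp by (simp add: left_diff_distrib pc)
    also have "\<dots> = s * (t * t ^ n)" by (simp only: p(7)[symmetric] mult.assoc)
    finally show "t ^ n = s * t ^ Suc n" by (simp only: power_Suc)
  qed
  have in_AS: "n \<in> AS" if "t ^ n * p = 0" for n
    unfolding AS
  proof (intro allI impI)
    fix x assume "F (Suc n) x = 0"
    then have "cblinfun_apply (endo_op (s * t ^ Suc n)) x = 0"
      by (simp only: mult F_def cblinfun_right_simps)
    then show "F n x = 0" unfolding F_def eq(2)[OF that, symmetric] .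
  qed
  have in_DS: "n \<in> DS" if "t ^ n * p = 0" for n
    unfolding DS
  proof (intro allI)
    fix x
    have "F n x = cblinfun_apply (endo_op (t ^ Suc n * s)) x"
      unfolding F_def eq(1)[OF that, symmetric] ..
    then show "\<exists>y. F n x = F (Suc n) y" by (auto simp only: mult F_def)
  qed
  have "n \<in> DS" if n: "n \<in> AS" for n
  proof (rule in_DS, rule endo_eqI)
    have null: "F (n + j) x = 0 \<Longrightarrow> F n x = 0" for j x
    proof (induction j)
      case (Suc j)
      have "F (Suc n) (F j x) = 0" using Suc.prems F_add[of "Suc n" j x] by simp
      then have "F (n + j) x = 0" using n F_add[of n j x] by (simp add: AS)
      then show ?case by (rule Suc.IH)
    qed simp
    fix x
    have "t ^ (n + k) * p = 0" by (simp add: power_add mult.assoc p(5))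
    then have "F (n + k) (cblinfun_apply (endo_op p) x) = 0"
      unfolding F_def mult[symmetric] by (simp add: endo_op_simps)
    then have "F n (cblinfun_apply (endo_op p) x) = 0" by (rule null)
    then show "cblinfun_apply (endo_op (t ^ n * p)) x = cblinfun_apply (endo_op 0) x"
      by (simp add: mult F_def endo_op_simps)
  qed
  moreover have "n \<in> AS" if n: "n \<in> DS" for n
  proof (rule in_AS, rule endo_eqI)
    have range: "\<exists>y. F n x = F (n + j) y" for j x
    proof (induction j)
      case (Suc j)
      then obtain y where y: "F n x = F (n + j) y" by blast
      obtain z where "F n y = F (Suc n) z" using n by (auto simp: DS)
      then have "F (j + n) y = F (j + Suc n) z" by (simp only: F_add)
      with y show ?case by (auto simp: add.commute)
    qed auto
    fix x
    obtain y where y: "F n x = F (n + k) y" using range by blast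
    have "p * t ^ (n + k) = 0" unfolding pc by (simp add: power_add mult.assoc p(5))
    then have "cblinfun_apply (endo_op (p * t ^ (n + k))) y = 0"
      by (simp only: endo_op_simps)
    then have "cblinfun_apply (endo_op p) (F n x) = 0"
      unfolding y by (simp only: mult F_def)
    then show "cblinfun_apply (endo_op (t ^ n * p)) x = cblinfun_apply (endo_op 0) x"
      unfolding pc[symmetric] by (simp add: mult F_def endo_op_simps)
  qed
  ultimately have eq_sets: "AS = DS" by blast
  then show "ascent T = descent T" by (simp add: ascent_def descent_def AS_def DS_def)
  have "k \<in> DS" by (rule in_DS[OF p(5)])
  then have "descent T \<le> enat k"
    unfolding descent_def DS_def[symmetric] by (intro Inf_lower) auto
  then show "descent T < \<infinity>" by (rule order_le_less_trans) simp
qed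

lemma isolated_of_drazin:
  assumes "l \<in> spectrum T" "drazin (Endo T - l *\<^sub>C 1)"
  shows "l isolated_in spectrum T"
proof -
  have "eventually (\<lambda>m. unit_elem (Endo T - l *\<^sub>C 1 - m *\<^sub>C 1)) (at 0)"
    by (rule drazin_punctured_neighbourhood[OF assms(2)])
  then obtain e where e: "0 < e"
    "\<And>m. m \<noteq> 0 \<Longrightarrow> cmod m < e \<Longrightarrow> unit_elem (Endo T - l *\<^sub>C 1 - m *\<^sub>C 1)"
    by (auto simp: eventually_at)
  have "m = l" if "m \<in> spectrum T" "dist l m < e" for m
  proof (rule ccontr)
    assume "m \<noteq> l"
    with e(2)[of "m - l"] that(2) have "unit_elem (Endo T - m *\<^sub>C 1)"
      by (simp add: dist_norm norm_minus_commute scaleC_simps)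
    with that(1) show False by (simp add: spectrum_eq_alg_spectrum alg_spectrum_def)
  qed
  then have "ball l e \<inter> spectrum T = {l}" using assms(1) e(1) by auto
  then show ?thesis using assms(1) e(1) unfolding isolated_in_def by (metis open_ball)
qed

lemma polaroid_iff_drazin:
  "polaroid T \<longleftrightarrow> (\<forall>l. l isolated_in spectrum T \<longrightarrow> drazin (Endo T - l *\<^sub>C 1))"
proof -
  have "l \<in> op_poles T \<longleftrightarrow> l \<in> spectrum T \<and> drazin (Endo T - l *\<^sub>C 1)" for l
    using finite_ascent_descent_imp_drazin[of "T - l *\<^sub>C id_cblinfun"]
      drazin_imp_finite_ascent_descent[of "T - l *\<^sub>C id_cblinfun"]
    by (auto simp: op_poles_def Endo_minus_scalar)
  then have "op_poles T = {l \<in> spectrum T. drazin (Endo T - l *\<^sub>C 1)}" by blast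
  then show ?thesis
    unfolding polaroid_def using isolated_of_drazin by (auto simp: isolated_in_def)
qed

section \<open>Approximate eigenvectors\<close>

text \<open>A frontier point belongs to the spectrum and is a limit of points outside it, where the
  resolvent norm is at least the reciprocal of the distance.\<close>

lemma resolvent_large:
  assumes l: "l \<in> frontier (alg_spectrum a)" and e: "0 < e"
  obtains m where "m \<notin> alg_spectrum a" "cmod (m - l) < e" "1 / e < norm (resolvent a m)"
proof -
  have "l \<in> closure (- alg_spectrum a)" "l \<in> alg_spectrum a"
    using l frontier_subset_closed[OF closed_alg_spectrum[of a]] by (auto simp: frontier_closures)
  then obtain m where m: "m \<notin> alg_spectrum a" "cmod (m - l) < e"
    using e unfolding closure_approachable by (auto simp: dist_norm)
  have "1 \<le> cmod (m - l) * norm (resolvent a m)"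
    using norm_resolvent_ge[OF \<open>l \<in> alg_spectrum a\<close> m(1)] .
  then have "norm (resolvent a m) \<noteq> 0" by auto
  then have "cmod (m - l) * norm (resolvent a m) < e * norm (resolvent a m)"
    using m(2) by (intro mult_strict_right_mono) auto
  with \<open>1 \<le> _\<close> have "1 < e * norm (resolvent a m)" by linarith
  with m e show thesis by (intro that) (auto simp: field_simps)
qed

text \<open>Both \<open>S u\<close> and \<open>f S\<close>, where \<open>S\<close> is a large resolvent close to \<open>l\<close>, \<open>S\<close> nearly attains its norm
  at \<open>u\<close> and \<open>f\<close> is a norming functional of \<open>S u\<close>, are almost annihilated by \<open>T - l\<close>.\<close>

lemma approximate_eigenvectors:
  fixes T :: "'a::cbanach \<Rightarrow>\<^sub>C\<^sub>L 'a"
  assumes l: "l \<in> frontier (spectrum T)" and e: "0 < e"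
  shows "\<exists>x. norm x = 1 \<and> norm (cblinfun_apply (T - l *\<^sub>C id_cblinfun) x) \<le> e"
    and "\<exists>f :: 'a \<Rightarrow>\<^sub>C\<^sub>L complex. norm f = 1 \<and> norm (f o\<^sub>C\<^sub>L (T - l *\<^sub>C id_cblinfun)) \<le> e"
proof -
  \<comment> \<open>One half of \<open>e\<close> pays for \<open>W\<close>, the other for the shift
    \<open>m - l\<close> in \<open>U = W + (m - l)\<close>.\<close>
  define d where "d = e / 2"
  have d: "0 < d" using e by (simp add: d_def)
  obtain m where m: "m \<notin> alg_spectrum (Endo T)" "cmod (m - l) < d"
    "1 / d < norm (resolvent (Endo T) m)"
    using resolvent_large[OF l[unfolded spectrum_eq_alg_spectrum] d] .
  define S where "S = endo_op (resolvent (Endo T) m)"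
  define U where "U = T - l *\<^sub>C id_cblinfun"
  define W where "W = T - m *\<^sub>C id_cblinfun"
  have UW: "cblinfun_apply U x = cblinfun_apply W x + (m - l) *\<^sub>C x" for x
    by (simp add: U_def W_def cblinfun_left_simps complex_vector.scale_left_diff_distrib)
  have SW: "cblinfun_apply S (cblinfun_apply W x) = x" and WS: "cblinfun_apply W (cblinfun_apply S x) = x" for x
    using arg_cong[OF resolvent(1)[OF m(1)], of "\<lambda>s. cblinfun_apply (endo_op s) x"]
      arg_cong[OF resolvent(2)[OF m(1)], of "\<lambda>s. cblinfun_apply (endo_op s) x"]
    by (simp_all add: S_def W_def endo_op_simps)
  have "1 / d < norm S" using m(3) by (simp add: S_def norm_endo.rep_eq)
  then obtain u where u: "1 / d * norm u < norm (cblinfun_apply S u)" "u \<noteq> 0"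
    using d by (elim norm_cblinfun_witness[rotated]) auto
  define x where "x = cblinfun_apply S u"
  have x: "norm u < d * norm x" using u(1) d by (simp add: x_def field_simps)
  then have x0: "0 < norm x" using d norm_ge_zero[of u] by (smt (verit) mult_nonneg_nonpos)
  have small: "cmod (m - l) * r \<le> d * r" if "0 \<le> r" for r
    using m(2) that by (intro mult_right_mono) auto
  have "norm (cblinfun_apply U x) \<le> norm u + cmod (m - l) * norm x"
    unfolding UW x_def WS by (rule order_trans[OF norm_triangle_ineq]) (simp add: norm_scaleC)
  also have "\<dots> \<le> e * norm x" using x small[of "norm x"] by (simp add: d_def)
  finally have Ux: "norm (cblinfun_apply U x) \<le> e * norm x" .
  define x' where "x' = complex_of_real (1 / norm x) *\<^sub>C x"
  have "norm x' = 1" using x0 by (simp add: x'_def norm_scaleC norm_divide)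
  moreover have "norm (cblinfun_apply U x') \<le> e"
    using Ux x0 by (simp add: x'_def norm_scaleC norm_divide cblinfun_scaleC_right field_simps)
  ultimately show "\<exists>x. norm x = 1 \<and> norm (cblinfun_apply (T - l *\<^sub>C id_cblinfun) x) \<le> e"
    unfolding U_def by blast
  obtain f :: "'a \<Rightarrow>\<^sub>C\<^sub>L complex" where f: "norm f \<le> 1" "cblinfun_apply f x = norm x"
    by (rule norming_functional)
  \<comment> \<open>Composed with \<open>W\<close>, the functional \<open>g\<close> becomes
    \<open>f\<close>, whose norm is at most 1, while \<open>norm g\<close> is at least
    \<open>1 / d\<close>.\<close>
  define g where "g = f o\<^sub>C\<^sub>L S"
  have "norm x \<le> norm g * norm u"
    using norm_cblinfun[of g u] f(2) by (simp add: g_def cblinfun_left_simps flip: x_def)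
  also have "\<dots> \<le> norm g * (d * norm x)" using x by (intro mult_left_mono) auto
  finally have g: "1 \<le> norm g * d" using x0 by (simp add: field_simps)
  then have g0: "0 < norm g" using zero_less_norm_iff by fastforce
  have "norm (g o\<^sub>C\<^sub>L U) \<le> e * norm g"
  proof (rule norm_cblinfun_bound)
    fix y
    have "norm (cblinfun_apply (g o\<^sub>C\<^sub>L U) y) = norm (cblinfun_apply f y + (m - l) * cblinfun_apply g y)"
      by (simp add: g_def cblinfun_left_simps UW cblinfun_right_simps SW)
    also have "\<dots> \<le> norm (cblinfun_apply f y) + cmod (m - l) * norm (cblinfun_apply g y)"
      by (rule order_trans[OF norm_triangle_ineq]) (simp add: norm_mult)
    also have "norm (cblinfun_apply f y) \<le> norm g * d * norm y"
      using norm_cblinfun[of f y] mult_right_mono[OF order_trans[OF f(1) g], of "norm y"] by simp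
    also have "cmod (m - l) * norm (cblinfun_apply g y) \<le> d * (norm g * norm y)"
      by (rule order_trans[OF small]) (use d in \<open>auto intro: mult_left_mono norm_cblinfun\<close>)
    finally show "norm (cblinfun_apply (g o\<^sub>C\<^sub>L U) y) \<le> e * norm g * norm y"
      by (simp add: d_def field_simps)
  qed (use e in simp)
  moreover define c where "c = complex_of_real (1 / norm g)"
  then have c: "cmod c = 1 / norm g" unfolding c_def norm_of_real by simp
  have "(c *\<^sub>C g) o\<^sub>C\<^sub>L U = c *\<^sub>C (g o\<^sub>C\<^sub>L U)"
    by (rule cblinfun_eqI) (simp add: cblinfun_left_simps)
  ultimately have "norm (c *\<^sub>C g) = 1 \<and> norm ((c *\<^sub>C g) o\<^sub>C\<^sub>L U) \<le> e"
    using g0 by (simp add: norm_scaleC c field_simps)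
  then show "\<exists>f :: 'a \<Rightarrow>\<^sub>C\<^sub>L complex. norm f = 1 \<and> norm (f o\<^sub>C\<^sub>L (T - l *\<^sub>C id_cblinfun)) \<le> e"
    unfolding U_def by blast
qed

text \<open>The first hypothesis gives injectivity, closed range and a bound for the inverse; the
  second is density of the range in its dual form, by Hahn-Banach.\<close>

lemma unit_elem_Endo_of_bounded_below:
  fixes T :: "'a::cbanach \<Rightarrow>\<^sub>C\<^sub>L 'a"
  assumes below: "\<And>x. norm x \<le> C * norm (cblinfun_apply T x)"
    and dense: "\<And>f :: 'a \<Rightarrow>\<^sub>C\<^sub>L complex. f o\<^sub>C\<^sub>L T = 0 \<Longrightarrow> f = 0"
  shows "unit_elem (Endo T)"
proof -
  let ?T = "cblinfun_apply T"
  have inj: "x = y" if "?T x = ?T y" for x y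
    using below[of "x - y"] that by (simp add: cblinfun_right_simps)
  have "\<exists>x. ?T x = y" for y
  proof (rule ccontr)
    assume no: "\<nexists>x. ?T x = y"
    have "\<exists>d>0. \<forall>m\<in>range ?T. d \<le> norm (y - m)"
    proof (rule ccontr)
      assume "\<not> ?thesis"
      then have "\<exists>x. norm (y - ?T x) < 1 / real (Suc n)" for n
        by (force simp: not_le)
      then obtain x where x: "\<And>n. norm (y - ?T (x n)) < 1 / real (Suc n)" by metis
      have "(\<lambda>n. y - ?T (x n)) \<longlonglongrightarrow> 0"
        by (rule Lim_null_comparison[OF always_eventually LIMSEQ_Suc[OF lim_1_over_n]])
          (use x less_imp_le in blast)
      then have lim: "(\<lambda>n. ?T (x n)) \<longlonglongrightarrow> y"
        using tendsto_diff[OF tendsto_const[of y], of "\<lambda>n. y - ?T (x n)" 0] by simp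
      have "Cauchy x"
      proof (rule metric_CauchyI)
        fix e :: real assume "0 < e"
        then have "0 < e / (\<bar>C\<bar> + 1)" by (simp add: add_nonneg_pos)
        then obtain N where N: "\<And>m n. m \<ge> N \<Longrightarrow> n \<ge> N \<Longrightarrow> dist (?T (x m)) (?T (x n)) < e / (\<bar>C\<bar> + 1)"
          using LIMSEQ_imp_Cauchy[OF lim] unfolding Cauchy_def by blast
        have "dist (x m) (x n) < e" if "m \<ge> N" "n \<ge> N" for m n
        proof -
          have "dist (x m) (x n) \<le> C * dist (?T (x m)) (?T (x n))"
            using below[of "x m - x n"] by (simp add: dist_norm cblinfun_right_simps)
          also have "\<dots> \<le> (\<bar>C\<bar> + 1) * dist (?T (x m)) (?T (x n))"
            by (intro mult_right_mono) auto
          also have "\<dots> < (\<bar>C\<bar> + 1) * (e / (\<bar>C\<bar> + 1))"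
            using N[OF that] by (intro mult_strict_left_mono) (auto simp: add_nonneg_pos)
          also have "\<dots> = e" by (simp add: add_nonneg_pos less_imp_neq[symmetric])
          finally show ?thesis .
        qed
        then show "\<exists>N. \<forall>m\<ge>N. \<forall>n\<ge>N. dist (x m) (x n) < e" by blast
      qed
      then obtain x0 where "x \<longlonglongrightarrow> x0" using Cauchy_convergent_iff convergent_def by blast
      then have "(\<lambda>n. ?T (x n)) \<longlonglongrightarrow> ?T x0"
        by (rule bounded_linear.tendsto[OF bounded_linear_cblinfun_apply])
      with lim no show False using LIMSEQ_unique by blast
    qed
    then obtain d where d: "0 < d" "\<And>m. m \<in> range ?T \<Longrightarrow> d \<le> norm (y - m)" by blast
    have "\<exists>f :: 'a \<Rightarrow>\<^sub>C\<^sub>L complex. (\<forall>m\<in>range ?T. cblinfun_apply f m = 0) \<and> cblinfun_apply f y \<noteq> 0"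
      by (rule hahn_banach_dist[of "range ?T" d y])
        (use d in \<open>auto simp flip: cblinfun_right_simps\<close>)
    then obtain f :: "'a \<Rightarrow>\<^sub>C\<^sub>L complex"
      where f: "\<And>x. cblinfun_apply f (?T x) = 0" "cblinfun_apply f y \<noteq> 0" by blast
    from f(1) have "f o\<^sub>C\<^sub>L T = 0"
      by (intro cblinfun_eqI) (simp add: cblinfun_left_simps)
    from dense[OF this] f(2) show False by (simp add: cblinfun_left_simps)
  qed
  then obtain S where S: "\<And>y. ?T (S y) = y" by metis
  have ST: "S (?T x) = x" for x using S[of "?T x"] by (rule inj)
  have app: "cblinfun_apply (CBlinfun S) = S"
  proof (rule cblinfun_apply_CBlinfun)
    show "S (x + y) = S x + S y" for x y by (rule inj) (simp add: S cblinfun_right_simps)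
    show "S (c *\<^sub>C x) = c *\<^sub>C S x" for c x by (rule inj) (simp add: S cblinfun_right_simps)
    show "norm (S x) \<le> C * norm x" for x using below[of "S x"] by (simp add: S)
  qed
  show ?thesis
    unfolding unit_elem_Endo_iff
    by (intro exI[of _ "CBlinfun S"] conjI cblinfun_eqI) (simp_all add: cblinfun_left_simps app S ST)
qed

section \<open>The spectrum of a generalized derivation\<close>

lemma generalized_derivation_minus_scalar:
  "cblinfun_apply (cblinfun_apply (generalized_derivation A B - l *\<^sub>C id_cblinfun) U) y =
    cblinfun_apply (A - a *\<^sub>C id_cblinfun) (cblinfun_apply U y)
      - cblinfun_apply U (cblinfun_apply (B - b *\<^sub>C id_cblinfun) y)"
  if "l = a - b"
  by (simp add: generalized_derivation.rep_eq cblinfun_left_simps cblinfun_right_simps that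
      complex_vector.scale_left_diff_distrib)

text \<open>\<open>TB\<close> is bounded below: for \<open>U = R (rank_one z f)\<close> with
  \<open>f\<close> norming \<open>y\<close>, the vector \<open>(D U) y\<close> equals
  \<open>norm y\<close> times \<open>z\<close>; applying the approximate eigenfunctional
  \<open>g\<close> of \<open>A\<close> makes the \<open>TA\<close> term small, so
  \<open>TB y\<close> cannot be small. \<open>TB\<close> has dense range: if \<open>f\<close> kills
  it, \<open>D\<close> sends \<open>rank_one x f\<close> to \<open>rank_one (TA x) f\<close>, which
  is too small for an invertible \<open>D\<close> unless \<open>f = 0\<close>.\<close>

lemma invertible_derivation_frontier_left:
  fixes A :: "'x::cbanach \<Rightarrow>\<^sub>C\<^sub>L 'x" and B :: "'y::cbanach \<Rightarrow>\<^sub>C\<^sub>L 'y"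
  assumes inv: "a - b \<notin> spectrum (generalized_derivation A B)" and a: "a \<in> frontier (spectrum A)"
  shows "b \<notin> spectrum B"
proof -
  define TA where "TA = A - a *\<^sub>C id_cblinfun"
  define TB where "TB = B - b *\<^sub>C id_cblinfun"
  define D where "D = generalized_derivation A B - (a - b) *\<^sub>C id_cblinfun"
  have D: "cblinfun_apply (cblinfun_apply D U) y = cblinfun_apply TA (cblinfun_apply U y)
      - cblinfun_apply U (cblinfun_apply TB y)" for U y
    unfolding D_def TA_def TB_def by (rule generalized_derivation_minus_scalar) simp
  obtain R where "R o\<^sub>C\<^sub>L D = id_cblinfun" "D o\<^sub>C\<^sub>L R = id_cblinfun"
    using inv by (auto simp: spectrum_def D_def)
  then have R: "cblinfun_apply R (cblinfun_apply D U) = U" "cblinfun_apply D (cblinfun_apply R U) = U" for U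
    by (metis cblinfun_compose.rep_eq id_cblinfun.rep_eq)+
  define C where "C = norm R"
  \<comment> \<open>Ensures \<open>C * e \<le> 1 / 4\<close>, below the factor \<open>1 / 2\<close>
    with which \<open>g\<close> nearly attains its norm at \<open>z\<close>; the summand 4 covers
    \<open>C = 0\<close>.\<close>
  define e where "e = 1 / (4 * C + 4)"
  have C: "0 \<le> C" by (simp add: C_def)
  have e: "0 < e" "C * e \<le> 1 / 4" using C by (simp_all add: e_def divide_simps)
  obtain x where x: "norm x = 1" "norm (cblinfun_apply TA x) \<le> e"
    using approximate_eigenvectors(1)[OF a e(1)] unfolding TA_def by blast
  obtain g :: "'x \<Rightarrow>\<^sub>C\<^sub>L complex" where g: "norm g = 1" "norm (g o\<^sub>C\<^sub>L TA) \<le> e"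
    using approximate_eigenvectors(2)[OF a e(1)] unfolding TA_def by blast
  have "unit_elem (Endo TB)"
  proof (rule unit_elem_Endo_of_bounded_below)
    fix y
    obtain f :: "'y \<Rightarrow>\<^sub>C\<^sub>L complex" where f: "norm f \<le> 1" "cblinfun_apply f y = norm y"
      by (rule norming_functional)
    obtain z where z: "1 / 2 * norm z < norm (cblinfun_apply g z)"
      using norm_cblinfun_witness[of "1 / 2" g] g(1) by auto
    define U where "U = cblinfun_apply R (rank_one z f)"
    have U: "norm U \<le> C * norm z"
    proof -
      have "norm U \<le> C * (norm z * norm f)"
        unfolding U_def C_def using norm_cblinfun[of R "rank_one z f"] by (simp add: norm_rank_one)
      also have "\<dots> \<le> C * (norm z * 1)" by (intro mult_left_mono f C) simp
      finally show ?thesis by simp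
    qed
    have "cblinfun_apply g (cblinfun_apply (cblinfun_apply D U) y) = norm y * cblinfun_apply g z"
      by (simp add: U_def R rank_one.rep_eq f cblinfun_right_simps)
    then have eq: "norm y * cblinfun_apply g z = cblinfun_apply (g o\<^sub>C\<^sub>L TA) (cblinfun_apply U y)
        - cblinfun_apply g (cblinfun_apply U (cblinfun_apply TB y))"
      by (simp add: D cblinfun_right_simps cblinfun_left_simps)
    have 1: "norm (cblinfun_apply (g o\<^sub>C\<^sub>L TA) (cblinfun_apply U y)) \<le> 1 / 4 * (norm z * norm y)"
    proof -
      have "norm (cblinfun_apply (g o\<^sub>C\<^sub>L TA) (cblinfun_apply U y)) \<le> e * (C * norm z * norm y)"
        by (rule order_trans[OF norm_cblinfun mult_mono[OF g(2) order_trans[OF norm_cblinfun mult_right_mono[OF U]]]])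
          (use e in auto)
      also have "\<dots> = (C * e) * (norm z * norm y)" by (simp add: mult_ac)
      also have "\<dots> \<le> 1 / 4 * (norm z * norm y)" by (intro mult_right_mono e) simp
      finally show ?thesis .
    qed
    have 2: "norm (cblinfun_apply g (cblinfun_apply U (cblinfun_apply TB y))) \<le> C * norm z * norm (cblinfun_apply TB y)"
      using order_trans[OF norm_cblinfun[of g]] order_trans[OF norm_cblinfun mult_right_mono[OF U]] g(1)
      by (metis mult_1 norm_ge_zero)
    have "1 / 2 * norm z * norm y \<le> norm (cblinfun_apply g z) * norm y"
      using z by (intro mult_right_mono) auto
    also have "\<dots> \<le> 1 / 4 * (norm z * norm y) + C * norm z * norm (cblinfun_apply TB y)"
      using norm_triangle_ineq4[of "cblinfun_apply (g o\<^sub>C\<^sub>L TA) (cblinfun_apply U y)"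
          "cblinfun_apply g (cblinfun_apply U (cblinfun_apply TB y))"] 1 2
      unfolding eq[symmetric] by (simp add: norm_mult mult.commute)
    finally have "norm z * norm y \<le> norm z * (4 * C * norm (cblinfun_apply TB y))"
      by (simp add: algebra_simps)
    moreover have "0 < norm z" using z by (auto simp: cblinfun_right_simps)
    ultimately show "norm y \<le> (4 * C) * norm (cblinfun_apply TB y)" by simp
  next
    fix f :: "'y \<Rightarrow>\<^sub>C\<^sub>L complex"
    assume f: "f o\<^sub>C\<^sub>L TB = 0"
    then have fTB: "cblinfun_apply f (cblinfun_apply TB y) = 0" for y
      by (metis cblinfun_compose.rep_eq zero_cblinfun.rep_eq)
    have "cblinfun_apply D (rank_one x f) = rank_one (cblinfun_apply TA x) f"
      by (rule cblinfun_eqI) (simp add: D rank_one.rep_eq cblinfun_right_simps fTB)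
    then have "rank_one x f = cblinfun_apply R (rank_one (cblinfun_apply TA x) f)" using R(1) by metis
    then have "norm f \<le> C * (norm (cblinfun_apply TA x) * norm f)"
      using norm_cblinfun[of R "rank_one (cblinfun_apply TA x) f"] norm_rank_one[of x f] x(1)
      by (simp add: C_def norm_rank_one)
    also have "\<dots> \<le> C * (e * norm f)" by (intro mult_left_mono mult_right_mono x C) simp
    also have "\<dots> \<le> 1 / 4 * norm f" using mult_right_mono[OF e(2), of "norm f"] by (simp add: mult.assoc)
    finally show "f = 0" by simp
  qed
  then show ?thesis
    by (simp add: spectrum_eq_alg_spectrum alg_spectrum_def TB_def Endo_minus_scalar)
qed

text \<open>The mirror image, with the roles exchanged: rank-one operators built from an approximate
  eigenfunctional of \<open>B\<close> bound \<open>TA\<close> below, and approximate eigenvectors of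
  \<open>B\<close> give the density of its range.\<close>

lemma invertible_derivation_frontier_right:
  fixes A :: "'x::cbanach \<Rightarrow>\<^sub>C\<^sub>L 'x" and B :: "'y::cbanach \<Rightarrow>\<^sub>C\<^sub>L 'y"
  assumes inv: "a - b \<notin> spectrum (generalized_derivation A B)" and b: "b \<in> frontier (spectrum B)"
  shows "a \<notin> spectrum A"
proof -
  define TA where "TA = A - a *\<^sub>C id_cblinfun"
  define TB where "TB = B - b *\<^sub>C id_cblinfun"
  define D where "D = generalized_derivation A B - (a - b) *\<^sub>C id_cblinfun"
  have D: "cblinfun_apply (cblinfun_apply D U) y = cblinfun_apply TA (cblinfun_apply U y)
      - cblinfun_apply U (cblinfun_apply TB y)" for U y
    unfolding D_def TA_def TB_def by (rule generalized_derivation_minus_scalar) simp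
  obtain R where "R o\<^sub>C\<^sub>L D = id_cblinfun" "D o\<^sub>C\<^sub>L R = id_cblinfun"
    using inv by (auto simp: spectrum_def D_def)
  then have R: "cblinfun_apply R (cblinfun_apply D U) = U" "cblinfun_apply D (cblinfun_apply R U) = U" for U
    by (metis cblinfun_compose.rep_eq id_cblinfun.rep_eq)+
  define C where "C = norm R"
  have C: "0 \<le> C" by (simp add: C_def)
  have "unit_elem (Endo TA)"
  proof (rule unit_elem_Endo_of_bounded_below)
    define e where "e = 1 / (2 * C + 2)"
    have e: "0 < e" "C * e \<le> 1 / 2" using C by (simp_all add: e_def divide_simps)
    obtain f :: "'y \<Rightarrow>\<^sub>C\<^sub>L complex" where f: "norm f = 1" "norm (f o\<^sub>C\<^sub>L TB) \<le> e"
      using approximate_eigenvectors(2)[OF b e(1)] unfolding TB_def by blast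
    fix x
    have "cblinfun_apply D (rank_one x f) = rank_one (cblinfun_apply TA x) f - rank_one x (f o\<^sub>C\<^sub>L TB)"
      by (rule cblinfun_eqI) (simp add: D rank_one.rep_eq cblinfun_right_simps cblinfun_left_simps)
    then have "norm (cblinfun_apply D (rank_one x f)) \<le> norm (cblinfun_apply TA x) + norm x * e"
      using norm_triangle_ineq4[of "rank_one (cblinfun_apply TA x) f" "rank_one x (f o\<^sub>C\<^sub>L TB)"]
        mult_left_mono[OF f(2), of "norm x"]
      by (simp add: norm_rank_one f(1))
    then have "C * norm (cblinfun_apply D (rank_one x f)) \<le> C * (norm (cblinfun_apply TA x) + norm x * e)"
      by (intro mult_left_mono C)
    moreover have "norm x \<le> C * norm (cblinfun_apply D (rank_one x f))"
      using norm_cblinfun[of R "cblinfun_apply D (rank_one x f)"] by (simp add: R C_def norm_rank_one f(1))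
    moreover have "C * (norm x * e) \<le> 1 / 2 * norm x"
      using mult_right_mono[OF e(2), of "norm x"] by (simp add: mult_ac)
    ultimately show "norm x \<le> (2 * C) * norm (cblinfun_apply TA x)" by (simp add: algebra_simps)
  next
    fix g :: "'x \<Rightarrow>\<^sub>C\<^sub>L complex"
    assume "g o\<^sub>C\<^sub>L TA = 0"
    then have gTA: "cblinfun_apply g (cblinfun_apply TA z) = 0" for z
      by (metis cblinfun_compose.rep_eq zero_cblinfun.rep_eq)
    have "cblinfun_apply g x = 0" for x
    proof (rule ccontr)
      assume gx: "cblinfun_apply g x \<noteq> 0"
      \<comment> \<open>\<open>K\<close> depends on \<open>g\<close> and \<open>x\<close>, so the
        accuracy \<open>e\<close> is fixed only now, small enough that \<open>K * e\<close> stays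
        below the modulus of \<open>g x\<close>.\<close>
      define K where "K = norm g * (C * norm x)"
      define e where "e = norm (cblinfun_apply g x) / (2 * K + 2)"
      have K: "0 \<le> K" using C by (simp add: K_def)
      have e: "0 < e" "K * e < norm (cblinfun_apply g x)"
      proof -
        show "0 < e" using K gx by (simp add: e_def add_nonneg_pos)
        have "K * norm (cblinfun_apply g x) < (2 * K + 2) * norm (cblinfun_apply g x)"
          using K gx by (intro mult_strict_right_mono) auto
        then show "K * e < norm (cblinfun_apply g x)"
          using K by (simp add: e_def divide_less_eq mult.commute add_nonneg_pos)
      qed
      obtain y where y: "norm y = 1" "norm (cblinfun_apply TB y) \<le> e"
        using approximate_eigenvectors(1)[OF b e(1)] unfolding TB_def by blast
      obtain f :: "'y \<Rightarrow>\<^sub>C\<^sub>L complex" where f: "norm f \<le> 1" "cblinfun_apply f y = norm y"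
        by (rule norming_functional)
      define U where "U = cblinfun_apply R (rank_one x f)"
      have U: "norm U \<le> C * norm x"
      proof -
        have "norm U \<le> C * (norm x * norm f)"
          unfolding U_def C_def using norm_cblinfun[of R "rank_one x f"] by (simp add: norm_rank_one)
        also have "\<dots> \<le> C * (norm x * 1)" by (intro mult_left_mono f C) simp
        finally show ?thesis by simp
      qed
      have "cblinfun_apply g (cblinfun_apply (cblinfun_apply D U) y) = cblinfun_apply g x"
        by (simp add: U_def R rank_one.rep_eq f y scaleC_one)
      then have "cblinfun_apply g x = - cblinfun_apply g (cblinfun_apply U (cblinfun_apply TB y))"
        by (simp add: D cblinfun_right_simps gTA)
      then have "norm (cblinfun_apply g x) = norm (cblinfun_apply g (cblinfun_apply U (cblinfun_apply TB y)))"
        by simp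
      also have "\<dots> \<le> norm g * (norm U * norm (cblinfun_apply TB y))"
        by (rule order_trans[OF norm_cblinfun mult_left_mono[OF norm_cblinfun]]) simp
      also have "\<dots> \<le> norm g * ((C * norm x) * e)"
        using U y(2) C by (intro mult_left_mono mult_mono) auto
      also have "\<dots> < norm (cblinfun_apply g x)" using e(2) by (simp add: K_def mult.assoc)
      finally show False by simp
    qed
    then show "g = 0" by (intro cblinfun_eqI) (simp add: zero_cblinfun.rep_eq)
  qed
  then show ?thesis
    by (simp add: spectrum_eq_alg_spectrum alg_spectrum_def TA_def Endo_minus_scalar)
qed

lemma compact_spectrum: "compact (spectrum T)"
  unfolding spectrum_eq_alg_spectrum compact_eq_bounded_closed
  using closed_alg_spectrum alg_spectrum_norm_le by (auto simp: bounded_iff)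

text \<open>The set of all \<open>g\<close> in the spectrum of \<open>A\<close> with \<open>g - (a - b)\<close> in the spectrum of \<open>B\<close> is compact and
  contains \<open>a\<close>, so it has a frontier point, which lies on the frontier of one of the two spectra.\<close>

lemma spectrum_generalized_derivation:
  fixes A :: "'x::cbanach \<Rightarrow>\<^sub>C\<^sub>L 'x" and B :: "'y::cbanach \<Rightarrow>\<^sub>C\<^sub>L 'y"
  assumes "a \<in> spectrum A" "b \<in> spectrum B"
  shows "a - b \<in> spectrum (generalized_derivation A B)"
proof -
  define l where "l = a - b"
  define SB where "SB = (+) l ` spectrum B"
  define K where "K = spectrum A \<inter> SB"
  have cl: "closed (spectrum A)" "closed SB"
    using compact_spectrum[of A] compact_translation[OF compact_spectrum[of B], of l]
    by (auto simp: SB_def compact_imp_closed)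
  have "a = l + b" by (simp add: l_def)
  then have "a \<in> K" using assms by (auto simp: K_def SB_def)
  moreover have "bounded K"
    using compact_spectrum[of A] by (auto simp: K_def intro: bounded_subset compact_imp_bounded)
  then have "K \<noteq> UNIV" using not_bounded_UNIV by auto
  ultimately have "frontier K \<noteq> {}" by (auto simp: frontier_eq_empty)
  then obtain g where g: "g \<in> frontier K" by blast
  have "closed K" using cl by (auto simp: K_def)
  then have gK: "g \<in> spectrum A" "g \<in> SB" using g frontier_subset_closed unfolding K_def by blast+
  then have gB: "g - l \<in> spectrum B" by (auto simp: SB_def)
  have "g \<in> frontier (spectrum A) \<or> g \<in> frontier SB"
    using frontier_Int_subset[of "spectrum A" SB] g by (auto simp: K_def)
  then show ?thesis
  proof
    assume "g \<in> frontier (spectrum A)"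
    then show ?thesis
      using invertible_derivation_frontier_left[of g "g - l" A B] gB by (auto simp: l_def)
  next
    assume "g \<in> frontier SB"
    then have "g - l \<in> frontier (spectrum B)"
      unfolding SB_def frontier_translation by (auto simp: add.commute)
    then show ?thesis
      using invertible_derivation_frontier_right[of g "g - l" A B] gK(1) by (auto simp: l_def)
  qed
qed

section \<open>Left and right multiplication operators\<close>

text \<open>As derivations with one operator zero, both multiplications inherit boundedness and
  complex linearity; the sign in \<open>right_mult\<close> cancels that of
  \<open>- U B\<close>.\<close>

definition left_mult :: "'x::cbanach endo \<Rightarrow> ('y::cbanach \<Rightarrow>\<^sub>C\<^sub>L 'x) endo" where
  "left_mult a = Endo (generalized_derivation (endo_op a) 0)"

definition right_mult :: "'y::cbanach endo \<Rightarrow> ('y \<Rightarrow>\<^sub>C\<^sub>L 'x::cbanach) endo" where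
  "right_mult b = - Endo (generalized_derivation 0 (endo_op b))"

lemma left_mult_apply:
  "cblinfun_apply (cblinfun_apply (endo_op (left_mult a)) U) y
    = cblinfun_apply (endo_op a) (cblinfun_apply U y)"
  by (simp add: left_mult_def generalized_derivation.rep_eq cblinfun_left_simps cblinfun_right_simps)

lemma right_mult_apply:
  "cblinfun_apply (cblinfun_apply (endo_op (right_mult b)) U) y
    = cblinfun_apply U (cblinfun_apply (endo_op b) y)"
  by (simp add: right_mult_def generalized_derivation.rep_eq endo_op_simps)

lemma endo_eqI2:
  "(\<And>U y. cblinfun_apply (cblinfun_apply (endo_op s) U) y = cblinfun_apply (cblinfun_apply (endo_op t) U) y)
    \<Longrightarrow> s = t"
  by (intro endo_eqI cblinfun_eqI) auto

lemma left_mult_mult: "left_mult (a * b) = left_mult a * left_mult b"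
  and left_mult_one: "left_mult 1 = 1"
  and left_mult_minus_scalar: "left_mult (a - l *\<^sub>C 1) = left_mult a - l *\<^sub>C 1"
  by (rule endo_eqI2, simp add: left_mult_apply endo_op_simps)+

lemma right_mult_mult: "right_mult (a * b) = right_mult b * right_mult a"
  and right_mult_one: "right_mult 1 = 1"
  and right_mult_minus_scalar: "right_mult (b - l *\<^sub>C 1) = right_mult b - l *\<^sub>C 1"
  by (rule endo_eqI2, simp add: right_mult_apply endo_op_simps cblinfun_right_simps)+

lemma left_mult_commute_right_mult: "left_mult a * right_mult b = right_mult b * left_mult a"
  by (rule endo_eqI2) (simp add: left_mult_apply right_mult_apply endo_op_simps)

lemma Endo_generalized_derivation:
  "Endo (generalized_derivation A B) = left_mult (Endo A) - right_mult (Endo B)"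
  by (rule endo_eqI2)
    (simp add: left_mult_apply right_mult_apply endo_op_simps generalized_derivation.rep_eq)

lemma unit_elem_left_mult: "unit_elem a \<Longrightarrow> unit_elem (left_mult a)"
  unfolding unit_elem_def by (metis left_mult_mult left_mult_one)

lemma unit_elem_right_mult: "unit_elem b \<Longrightarrow> unit_elem (right_mult b)"
  unfolding unit_elem_def by (metis right_mult_mult right_mult_one)

lemma drazin_left_mult:
  assumes "drazin a"
  shows "drazin (left_mult a)"
proof -
  obtain s k where s: "a * s = s * a" "s * a * s = s" "a ^ Suc k * s = a ^ k"
    using assms by (auto simp: drazin_def drazin_inverse_def)
  have pow: "left_mult a ^ n = left_mult (a ^ n)" for n
    by (induction n) (simp_all add: left_mult_mult left_mult_one)
  have "drazin_inverse (left_mult a) (left_mult s) k"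
    unfolding drazin_inverse_def pow left_mult_mult[symmetric] s by simp
  then show ?thesis by (rule drazinI)
qed

text \<open>\<open>right_mult\<close> reverses products, but the equations are symmetric because
  \<open>s\<close> commutes with \<open>b\<close> and its powers.\<close>

lemma drazin_right_mult:
  assumes "drazin b"
  shows "drazin (right_mult b)"
proof -
  obtain s k where "drazin_inverse b s k" using assms by (auto simp: drazin_def)
  then have s: "s * b = b * s" "s * (b * s) = s" "b ^ Suc k * s = b ^ k"
    unfolding drazin_inverse_def mult.assoc by metis+
  have pow: "right_mult b ^ n = right_mult (b ^ n)" for n
    by (induction n)
      (simp_all only: power_0 right_mult_one power_Suc2[of b] power_Suc[of "right_mult b"] right_mult_mult)
  have "s * b ^ Suc k = b ^ k" using s(3) commute_power[OF s(1), of "Suc k"] by simp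
  then have "drazin_inverse (right_mult b) (right_mult s) k"
    unfolding drazin_inverse_def pow right_mult_mult[symmetric] s by simp
  then show ?thesis by (rule drazinI)
qed

theorem theorem3p6:
  fixes A :: "'x::cbanach \<Rightarrow>\<^sub>C\<^sub>L 'x" and B :: "'y::cbanach \<Rightarrow>\<^sub>C\<^sub>L 'y"
  assumes "\<nexists>S :: 'x set. finite S \<and> cspan S = UNIV"
    and "\<nexists>S :: 'y set. finite S \<and> cspan S = UNIV"
    and "polaroid A"
    and "polaroid B"
  shows "polaroid (generalized_derivation A B)"
  unfolding polaroid_iff_drazin
proof (intro allI impI)
  fix l
  assume "l isolated_in spectrum (generalized_derivation A B)"
  then obtain e where e: "0 < e"
    "\<And>m. m \<in> spectrum (generalized_derivation A B) \<Longrightarrow> dist l m < e \<Longrightarrow> m = l"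
    unfolding isolated_in_dist_Ex_iff by blast
  define K where "K = {g \<in> spectrum A. g - l \<in> spectrum B}"
  have isoA: "g isolated_in spectrum A" if "g \<in> K" for g
    unfolding isolated_in_dist_Ex_iff
  proof (intro conjI exI[of _ e] ballI impI)
    fix h assume "h \<in> spectrum A" "dist g h < e"
    \<comment> \<open>Keeping \<open>g - l\<close> and moving \<open>g\<close> to \<open>h\<close>
      shifts the spectral value \<open>l\<close> of the derivation by \<open>h - g\<close>, so
      isolation of \<open>l\<close> with radius \<open>e\<close> carries over to
      \<open>g\<close>.\<close>
    then have "h - (g - l) = l"
      using that spectrum_generalized_derivation[of h A "g - l" B]
      by (intro e(2)) (auto simp: K_def dist_norm)
    then show "h = g" by simp
  qed (use that e(1) in \<open>auto simp: K_def\<close>)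
  have isoB: "g - l isolated_in spectrum B" if "g \<in> K" for g
    unfolding isolated_in_dist_Ex_iff
  proof (intro conjI exI[of _ e] ballI impI)
    fix h assume "h \<in> spectrum B" "dist (g - l) h < e"
    then have "g - h = l"
      using that spectrum_generalized_derivation[of g A h B]
      by (intro e(2)) (auto simp: K_def dist_norm norm_minus_commute algebra_simps)
    then show "h = g - l" by auto
  qed (use that e(1) in \<open>auto simp: K_def\<close>)
  \<comment> \<open>An infinite compact \<open>K\<close> would contain one of its limit points,
    which contradicts \<open>isoA\<close>.\<close>
  have "finite K"
  proof (rule ccontr)
    assume inf: "infinite K"
    have "K = spectrum A \<inter> (+) l ` spectrum B"
      by (force simp: K_def image_iff algebra_simps intro: bexI[of _ "_ - l"])
    then have "compact K"
      by (simp add: compact_Int compact_translation compact_spectrum)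
    then obtain g where "g \<in> K" "g islimpt K"
      using inf unfolding compact_eq_Bolzano_Weierstrass by blast
    then show False
      using isoA[of g] islimpt_subset[of g K "spectrum A"]
      by (auto simp: isolated_in_islimpt_iff K_def)
  qed
  \<comment> \<open>Placing \<open>l\<close> in \<open>a\<close> makes \<open>b - a\<close> the
    shifted derivation and puts the common spectral values of \<open>a\<close> and \<open>b\<close>
    into \<open>K\<close>.\<close>
  define a :: "('y \<Rightarrow>\<^sub>C\<^sub>L 'x) endo" where "a = right_mult (Endo B) + l *\<^sub>C 1"
  define b :: "('y \<Rightarrow>\<^sub>C\<^sub>L 'x) endo" where "b = left_mult (Endo A)"
  have a: "a - g *\<^sub>C 1 = right_mult (Endo B - (g - l) *\<^sub>C 1)" for g
    unfolding right_mult_minus_scalar by (simp add: a_def scaleC_simps)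
  have b: "b - g *\<^sub>C 1 = left_mult (Endo A - g *\<^sub>C 1)" for g
    by (simp add: b_def left_mult_minus_scalar)
  have "drazin (b - a)"
  proof (rule drazin_diff[OF \<open>finite K\<close>])
    show "a * b = b * a"
      by (simp add: a_def b_def distrib_left distrib_right scaleC_simps left_mult_commute_right_mult)
    show "alg_spectrum a \<inter> alg_spectrum b \<subseteq> K"
      unfolding alg_spectrum_def a b K_def spectrum_eq_alg_spectrum
      using unit_elem_left_mult unit_elem_right_mult by blast
    fix g assume g: "g \<in> K"
    show "drazin (a - g *\<^sub>C 1)"
      unfolding a using isoB[OF g] assms(4) polaroid_iff_drazin by (intro drazin_right_mult) blast
    show "drazin (b - g *\<^sub>C 1)"
      unfolding b using isoA[OF g] assms(3) polaroid_iff_drazin by (intro drazin_left_mult) blast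
  qed
  then show "drazin (Endo (generalized_derivation A B) - l *\<^sub>C 1)"
    by (simp add: a_def b_def Endo_generalized_derivation diff_diff_eq)
qed

end
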